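(* Let $T$ be a non-abelian finite simple group and let $k$ be an integer with $5\log_2|T|<k<|T|-5\log_2|T|$. Then $\mathbb{Q}_k(T)<1/|T|$.
   Context: For a finite group $X$, let $X^\#=X\setminus\{1\}$, let $\mathscr{S}_k(X)$ be the set of $k$-element subsets of $X^\#$, and for $R\subseteq X^\#$ let $\mathrm{Aut}(X,R)$ be the setwise stabiliser of $R$ in $\mathrm{Aut}(X)$. Define $\mathbb{Q}_k(X)=|\{R\in\mathscr{S}_k(X):\mathrm{Aut}(X,R)\neq 1\}|/|\mathscr{S}_k(X)|$. *)

theory Defs
  imports "HOL-Algebra.Algebra" Complex_Main
begin

text \<open>Setwise stabiliser of R in Aut(X); automorphisms are the extensional
  bijective endomorphisms of the carrier (auto, from HOL-Algebra Bij).\<close>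
definition Aut_stab :: "('a, 'b) monoid_scheme \<Rightarrow> 'a set \<Rightarrow> ('a \<Rightarrow> 'a) set" where
  "Aut_stab G R = {f \<in> auto G. f ` R = R}"

definition S_k :: "('a, 'b) monoid_scheme \<Rightarrow> nat \<Rightarrow> 'a set set" where
  "S_k G k = {R. R \<subseteq> carrier G - {\<one>\<^bsub>G\<^esub>} \<and> card R = k}"

definition Q_k :: "('a, 'b) monoid_scheme \<Rightarrow> nat \<Rightarrow> real" where
  "Q_k G k = real (card {R \<in> S_k G k. Aut_stab G R \<noteq> {(\<lambda>x\<in>carrier G. x)}})
             / real (card (S_k G k))"

end

theory Submission
  imports Defs
begin

text \<open>
  A set \<open>R\<close> with nontrivial stabiliser is invariant under an automorphism \<open>f\<close> of prime order.
  Let \<open>C\<close> be the subgroup of fixed points of \<open>f\<close> and \<open>n\<close> the order of the group.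
  For a prescribed intersection with \<open>C\<close>, the number of invariant \<open>k\<close>-sets is at
  most the square root of the number of all \<open>k\<close>-sets with that intersection. So an invariant set
  either meets \<open>C\<close> in almost all of its points, or is one of very few.

  No classification is needed to sum this over all \<open>f\<close>. A simple group with a proper
  subgroup of index \<open>i\<close> embeds into the symmetric group of degree \<open>i\<close>, so indices of proper
  subgroups are at least 5, and at least 6 once \<open>n > 120\<close>. A subgroup of index \<open>i\<close> can be
  completed to the whole group by about \<open>log 2 i\<close> generators, hence at most \<open>n powr log 2 i\<close>
  automorphisms fix it pointwise. For \<open>n \<ge> 512\<close> one samples
  about \<open>5 * log 2 n\<close> points of \<open>R\<close> and groups the automorphisms by a subset of the
  sample that generates the same subgroup \<open>K\<close> as all the sampled fixed points. The remaining
  sampled fixed points have to fall into \<open>K\<close>, and this outweighs the number of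
  automorphisms that fix \<open>K\<close>.
  For \<open>n < 512\<close> the Cauchy--Schwarz inequality together with a bound for the number
  of generators suffices; the latter uses that two elements already
  generate a subgroup of order at least \<open>p\<^sup>2\<close> for every prime divisor \<open>p\<close> of \<open>n\<close>.
  The hypotheses on \<open>k\<close> force \<open>n \<ge> 60\<close>.
\<close>


section \<open>Invariant sets of permutations of prime order\<close>

lemma funpow_image_subset: "f ` R = R \<Longrightarrow> x \<in> R \<Longrightarrow> (f ^^ i) x \<in> R"
  by (induction i) auto

text \<open>Since \<open>p\<close> is prime, every orbit of \<open>f\<close> outside
  \<open>C\<close> has exactly \<open>p\<close> points. \<open>A\<close> takes one point from each
  of them; because \<open>p\<close> is at least 2, the complement of \<open>A\<close> meets these
  orbits as well, so an invariant set can be rebuilt from either side.\<close>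

lemma prime_period_transversal:
  fixes f :: "'a \<Rightarrow> 'a"
  assumes U: "finite U" "f ` U = U" and p: "Factorial_Ring.prime p"
    and per: "\<And>x. x \<in> U \<Longrightarrow> (f ^^ p) x = x"
    and C: "C = {x \<in> U. f x = x}"
  obtains A where "A \<subseteq> U - C"
    and "\<And>R. R \<subseteq> U \<Longrightarrow> f ` R = R \<Longrightarrow> p * card (R \<inter> A) = card (R - C)"
    and "\<And>R. R \<subseteq> U \<Longrightarrow> f ` R = R \<Longrightarrow> R - C = (\<Union>i. (f ^^ i) ` (R \<inter> A))"
    and "\<And>R. R \<subseteq> U \<Longrightarrow> f ` R = R \<Longrightarrow> R - C = (\<Union>i. (f ^^ i) ` (R - C - A))"
proof -
  have p0: "p > 1" using p prime_gt_1_nat by blast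
  have memU: "(f ^^ i) x \<in> U" if "x \<in> U" for x i
    using funpow_image_subset[OF U(2) that] .
  have perm: "(f ^^ (p * j)) x = x" if "x \<in> U" for x j
  proof (induction j)
    case (Suc j)
    then show ?case using per[OF that] by (simp add: funpow_add)
  qed simp
  have modp: "(f ^^ i) x = (f ^^ (i mod p)) x" if "x \<in> U" for x i
  proof -
    have "(f ^^ i) x = (f ^^ (i mod p + p * (i div p))) x" by simp
    also have "\<dots> = (f ^^ (i mod p)) x"
      unfolding funpow_add by (simp add: perm[OF that])
    finally show ?thesis .
  qed
  \<comment> \<open>On \<open>U\<close> the exponent \<open>p * i - i\<close> inverts
    \<open>f ^^ i\<close> without leaving the natural numbers.\<close>
  have bck: "(f ^^ (p * i - i)) ((f ^^ i) x) = x" if "x \<in> U" for x i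
  proof -
    have "i \<le> p * i" using p0 by simp
    then have "(f ^^ (p * i - i)) ((f ^^ i) x) = (f ^^ (p * i)) x"
      by (metis comp_apply funpow_add le_add_diff_inverse2)
    then show ?thesis using perm[OF that] by simp
  qed
  have notC: "(f ^^ i) x \<notin> C" if "x \<in> U - C" for x i
  proof
    assume "(f ^^ i) x \<in> C"
    then have "f ((f ^^ i) x) = (f ^^ i) x" using C by simp
    then have "(f ^^ i) (f x) = (f ^^ i) x" by (simp add: funpow_swap1)
    then have "(f ^^ (p * i - i)) ((f ^^ i) (f x)) = (f ^^ (p * i - i)) ((f ^^ i) x)" by simp
    moreover have "f x \<in> U" using that U by auto
    ultimately have "f x = x" using bck that by simp
    then show False using that C by simp
  qed
  have nofix: "d = 0" if "x \<in> U - C" "(f ^^ d) x = x" "d < p" for x d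
  proof (rule ccontr)
    assume d: "d \<noteq> 0"
    have "coprime d p" using d that(3) p
      by (metis coprime_commute dvd_imp_le linorder_not_le neq0_conv prime_imp_coprime_nat)
    \<comment> \<open>Bezout turns a return time coprime to \<open>p\<close> into the return time 1,
      which would make \<open>x\<close> a fixed point.\<close>
    then obtain a b where ab: "d * a = p * b + 1"
      using bezout_nat[OF d, of p] by auto
    have "(f ^^ (d * a)) x = x"
    proof (induction a)
      case (Suc a) then show ?case using that(2) by (simp add: funpow_add)
    qed simp
    then have "f ((f ^^ (p * b)) x) = x" using ab by simp
    then have "f x = x" using perm that(1) by simp
    then show False using that(1) C by simp
  qed
  have injp: "i = j" if "x \<in> U - C" "i < p" "j < p" "(f ^^ i) x = (f ^^ j) x" for x i j
  proof -
    have *: "i = j" if "i \<le> j" "x \<in> U - C" "j < p" "(f ^^ i) x = (f ^^ j) x" for i j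
    proof -
      have "(f ^^ j) x = (f ^^ i) ((f ^^ (j - i)) x)"
        using that(1) by (metis comp_apply funpow_add le_add_diff_inverse)
      then have "(f ^^ (p * i - i)) ((f ^^ i) x) = (f ^^ (p * i - i)) ((f ^^ i) ((f ^^ (j - i)) x))"
        using that(4) by simp
      then have "x = (f ^^ (j - i)) x" using bck memU that(2) by simp
      then have "j - i = 0" using nofix[OF that(2), of "j - i"] that(3) by simp
      then show ?thesis using that(1) by simp
    qed
    show ?thesis using *[of i j] *[of j i] that by (metis nle_le)
  qed
  define orb where "orb x = range (\<lambda>i. (f ^^ i) x)" for x
  have orb_self: "x \<in> orb x" for x unfolding orb_def by (rule range_eqI[of _ _ 0]) simp
  have orb_sub: "orb y \<subseteq> orb x" if "y \<in> orb x" for x y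
  proof -
    obtain i where i: "y = (f ^^ i) x" using \<open>y \<in> orb x\<close> unfolding orb_def by auto
    have "(f ^^ j) y = (f ^^ (j + i)) x" for j unfolding i funpow_add by simp
    then show ?thesis unfolding orb_def by auto
  qed
  have orb_sym: "x \<in> orb y" if "x \<in> U" "y \<in> orb x" for x y
  proof -
    obtain i where i: "y = (f ^^ i) x" using \<open>y \<in> orb x\<close> unfolding orb_def by auto
    show ?thesis unfolding orb_def i by (rule range_eqI[of _ _ "p * i - i"]) (simp only: bck[OF that(1)])
  qed
  have orb_eq: "orb y = orb x" if "x \<in> U" "y \<in> orb x" for x y
    using orb_sub[OF that(2)] orb_sub[OF orb_sym[OF that]] by auto
  \<comment> \<open>The choice depends on the set \<open>orb x\<close> alone, so all points of one
    orbit share their representative.\<close>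
  define rep where "rep x = (SOME y. y \<in> orb x)" for x
  have rep_in: "rep x \<in> orb x" for x unfolding rep_def using orb_self someI by metis
  define A where "A = {x \<in> U - C. rep x = x}"
  have main: "p * card (R \<inter> A) = card (R - C) \<and> R - C = (\<Union>i. (f ^^ i) ` (R \<inter> A))
      \<and> R - C = (\<Union>i. (f ^^ i) ` (R - C - A))" if R: "R \<subseteq> U" "f ` R = R" for R
  proof -
    have orbR: "orb x \<subseteq> R" if "x \<in> R" for x
      using funpow_image_subset[OF R(2) that] unfolding orb_def by auto
    have repA: "rep y \<in> R \<inter> A" "y \<in> orb (rep y)" if y: "y \<in> R - C" for y
    proof -
      have e: "orb (rep y) = orb y" using orb_eq[OF _ rep_in] y R by auto
      obtain i where i: "rep y = (f ^^ i) y" using rep_in[of y] unfolding orb_def by auto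
      have "rep y \<in> R" using orbR[of y] rep_in[of y] y by auto
      moreover have "rep y \<notin> C" using notC[of y i] i y R by auto
      moreover have "rep (rep y) = rep y" using e unfolding rep_def by simp
      ultimately show "rep y \<in> R \<inter> A" using R unfolding A_def by auto
      show "y \<in> orb (rep y)" using e orb_self by simp
    qed
    have bij: "bij_betw (\<lambda>(a, i). (f ^^ i) a) ((R \<inter> A) \<times> {..<p}) (R - C)"
    proof (rule bij_betw_imageI)
      show "inj_on (\<lambda>(a, i). (f ^^ i) a) ((R \<inter> A) \<times> {..<p})"
      proof (rule inj_onI, clarsimp)
        fix a i b j
        assume h: "a \<in> R" "a \<in> A" "i < p" "b \<in> R" "b \<in> A" "j < p" "(f ^^ i) a = (f ^^ j) b"
        have "a \<in> U" "b \<in> U" using h unfolding A_def by auto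
        then have "orb a = orb b" using h(7) orb_eq unfolding orb_def by (metis rangeI)
        then have "rep a = rep b" unfolding rep_def by simp
        then have "a = b" using h unfolding A_def by simp
        then show "a = b \<and> i = j" using h injp[of a i j] unfolding A_def by auto
      qed
      show "(\<lambda>(a, i). (f ^^ i) a) ` ((R \<inter> A) \<times> {..<p}) = R - C"
      proof
        show "(\<lambda>(a, i). (f ^^ i) a) ` ((R \<inter> A) \<times> {..<p}) \<subseteq> R - C"
          using funpow_image_subset[OF R(2)] notC unfolding A_def by auto
        show "R - C \<subseteq> (\<lambda>(a, i). (f ^^ i) a) ` ((R \<inter> A) \<times> {..<p})"
        proof
          fix y assume y: "y \<in> R - C"
          obtain i where "y = (f ^^ i) (rep y)" using repA(2)[OF y] unfolding orb_def by auto
          moreover have "rep y \<in> U" using repA(1)[OF y] R by auto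
          ultimately have "y = (f ^^ (i mod p)) (rep y)" using modp by metis
          then show "y \<in> (\<lambda>(a, i). (f ^^ i) a) ` ((R \<inter> A) \<times> {..<p})"
            using repA(1)[OF y] p0 by (intro image_eqI[of _ _ "(rep y, i mod p)"]) auto
        qed
      qed
    qed
    have "card (R - C) = card ((R \<inter> A) \<times> {..<p})" using bij_betw_same_card[OF bij] by simp
    then have 1: "p * card (R \<inter> A) = card (R - C)" by (simp add: card_cartesian_product)
    have 2: "R - C = (\<Union>i. (f ^^ i) ` (R \<inter> A))"
    proof
      show "R - C \<subseteq> (\<Union>i. (f ^^ i) ` (R \<inter> A))"
      proof
        fix y assume y: "y \<in> R - C"
        then show "y \<in> (\<Union>i. (f ^^ i) ` (R \<inter> A))" using repA[OF y] unfolding orb_def by auto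
      qed
      show "(\<Union>i. (f ^^ i) ` (R \<inter> A)) \<subseteq> R - C"
        using funpow_image_subset[OF R(2)] notC unfolding A_def by auto
    qed
    have 3: "R - C = (\<Union>i. (f ^^ i) ` (R - C - A))"
    proof
      show "R - C \<subseteq> (\<Union>i. (f ^^ i) ` (R - C - A))"
      proof
        fix y assume y: "y \<in> R - C"
        show "y \<in> (\<Union>i. (f ^^ i) ` (R - C - A))"
        proof (cases "y \<in> A")
          case False
          then have "y \<in> (f ^^ 0) ` (R - C - A)" using y by simp
          then show ?thesis by blast
        next
          case True
          have yU: "y \<in> U" using y R by auto
          \<comment> \<open>A representative \<open>y\<close> is reached from \<open>f y\<close>,
            which lies in the same orbit, differs from \<open>y\<close>, and hence is outside
            \<open>A\<close>.\<close>
          have fy: "f y \<in> orb y" unfolding orb_def by (rule range_eqI[of _ _ 1]) simp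
          then have "orb (f y) = orb y" using orb_eq yU by simp
          then have "rep (f y) = y" using True unfolding rep_def A_def by simp
          moreover have "f y \<noteq> y" using y yU C by simp
          ultimately have "f y \<notin> A" unfolding A_def by auto
          moreover have "f y \<in> R - C" using orbR[of y] fy y notC[of y 1] yU by auto
          moreover have "(f ^^ (p - 1)) (f y) = y"
            using per[OF yU] p0 by (metis Suc_diff_1 comp_apply funpow_Suc_right gr_implies_not0 neq0_conv)
          ultimately have "y \<in> (f ^^ (p - 1)) ` (R - C - A)" by (metis DiffI imageI)
          then show ?thesis by blast
        qed
      qed
      show "(\<Union>i. (f ^^ i) ` (R - C - A)) \<subseteq> R - C"
        using funpow_image_subset[OF R(2)] notC R(1) by blast
    qed
    show ?thesis using 1 2 3 by blast
  qed
  have "A \<subseteq> U - C" unfolding A_def by blast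
  then show thesis
  proof (rule that)
    fix R assume R: "R \<subseteq> U" "f ` R = R"
    show "p * card (R \<inter> A) = card (R - C)" using main[OF R] by (rule conjunct1)
    show "R - C = (\<Union>i. (f ^^ i) ` (R \<inter> A))" using main[OF R] by (elim conjE)
    show "R - C = (\<Union>i. (f ^^ i) ` (R - C - A))" using main[OF R] by (elim conjE)
  qed
qed

text \<open>If \<open>A\<close> is a transversal of the nontrivial orbits, then a pair \<open>(R1, R2)\<close> of invariant sets
  is recovered from the single set \<open>(R1 \<inter> A) \<union> (R2 - A)\<close>, since every nontrivial orbit
  also meets the complement of \<open>A\<close>.\<close>

lemma card_invariant_square_le:
  fixes f :: "'a \<Rightarrow> 'a"
  assumes U: "finite U" "f ` U = U" and p: "Factorial_Ring.prime p"
    and per: "\<And>x. x \<in> U \<Longrightarrow> (f ^^ p) x = x"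
    and C: "C = {x \<in> U. f x = x}"
  shows "(card {R. R \<subseteq> U \<and> card R = k \<and> f ` R = R \<and> R \<inter> C = B})\<^sup>2
    \<le> card {R. R \<subseteq> U \<and> card R = k \<and> R \<inter> C = B}"
proof -
  obtain A where A: "A \<subseteq> U - C"
    and a1: "\<And>R. R \<subseteq> U \<Longrightarrow> f ` R = R \<Longrightarrow> p * card (R \<inter> A) = card (R - C)"
    and a2: "\<And>R. R \<subseteq> U \<Longrightarrow> f ` R = R \<Longrightarrow> R - C = (\<Union>i. (f ^^ i) ` (R \<inter> A))"
    and a3: "\<And>R. R \<subseteq> U \<Longrightarrow> f ` R = R \<Longrightarrow> R - C = (\<Union>i. (f ^^ i) ` (R - C - A))"
    using prime_period_transversal[OF U p per C] by metis
  let ?F = "{R. R \<subseteq> U \<and> card R = k \<and> f ` R = R \<and> R \<inter> C = B}"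
  let ?H = "{R. R \<subseteq> U \<and> card R = k \<and> R \<inter> C = B}"
  let ?h = "\<lambda>(R1, R2). (R1 \<inter> A) \<union> (R2 - A)"
  have fin: "finite ?H" "finite ?F" using U(1) by auto
  have p0: "p > 0" using p prime_gt_0_nat by blast
  have "inj_on ?h (?F \<times> ?F)"
  proof (rule inj_onI, clarify)
    fix R1 R2 S1 S2
    assume R1: "R1 \<subseteq> U" "f ` R1 = R1" and R2: "R2 \<subseteq> U" "f ` R2 = R2"
      and S1: "S1 \<subseteq> U" "f ` S1 = S1" and S2: "S2 \<subseteq> U" "f ` S2 = S2"
      and c: "card S1 = card R1" "R2 \<inter> C = R1 \<inter> C" "S1 \<inter> C = R1 \<inter> C" "S2 \<inter> C = R1 \<inter> C"
      and e: "(R1 \<inter> A) \<union> (R2 - A) = (S1 \<inter> A) \<union> (S2 - A)"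
    have "R1 \<inter> A = S1 \<inter> A" using e by blast
    then have "R1 - C = S1 - C" using a2[OF R1] a2[OF S1] by simp
    then have 1: "R1 = S1" using c by blast
    have "R2 - C - A = S2 - C - A" using e by blast
    then have "R2 - C = S2 - C" using a3[OF R2] a3[OF S2] by simp
    then have 2: "R2 = S2" using c by blast
    show "R1 = S1 \<and> R2 = S2" using 1 2 by simp
  qed
  moreover have "?h ` (?F \<times> ?F) \<subseteq> ?H"
  proof (rule image_subsetI, clarify)
    fix R1 R2
    assume R1: "R1 \<subseteq> U" "f ` R1 = R1" and R2: "R2 \<subseteq> U" "f ` R2 = R2"
      and k: "card R2 = card R1" and B: "R2 \<inter> C = R1 \<inter> C"
    have f: "finite R1" "finite R2" using R1 R2 U finite_subset by auto
    have "card (R1 - C) = card R1 - card (R1 \<inter> C)" "card (R2 - C) = card R2 - card (R2 \<inter> C)"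
      using f by (simp_all add: card_Diff_subset_Int)
    \<comment> \<open>Equal size and equal trace on \<open>C\<close> force equally many
      representatives, so the mixed set has the same size again.\<close>
    then have "p * card (R1 \<inter> A) = p * card (R2 \<inter> A)" using a1 R1 R2 k B by simp
    then have e: "card (R1 \<inter> A) = card (R2 \<inter> A)" using p0 by simp
    have "card ((R1 \<inter> A) \<union> (R2 - A)) = card (R1 \<inter> A) + card (R2 - A)"
      using f by (intro card_Un_disjoint) auto
    also have "\<dots> = card R2" unfolding e using f(2) by (metis card_Int_Diff)
    finally have "card ((R1 \<inter> A) \<union> (R2 - A)) = card R1" using k by simp
    moreover have "((R1 \<inter> A) \<union> (R2 - A)) \<inter> C = R1 \<inter> C" using A B by blast
    ultimately show "(R1 \<inter> A) \<union> (R2 - A) \<subseteq> U \<and> card ((R1 \<inter> A) \<union> (R2 - A)) = card R1 \<and>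
        ((R1 \<inter> A) \<union> (R2 - A)) \<inter> C = R1 \<inter> C" using R1 R2 by auto
  qed
  ultimately have "card (?F \<times> ?F) \<le> card ?H" using fin(1) by (rule card_inj_on_le)
  then show ?thesis by (simp add: card_cartesian_product power2_eq_square)
qed

section \<open>Counting sets of a fixed size, and weighted sums over them\<close>

definition ksubs :: "'a set \<Rightarrow> nat \<Rightarrow> 'a set set" where
  "ksubs U k = {R. R \<subseteq> U \<and> card R = k}"

lemma finite_ksubs: "finite U \<Longrightarrow> finite (ksubs U k)"
  unfolding ksubs_def by (rule finite_subset[of _ "Pow U"]) auto

lemma card_ksubs: "finite U \<Longrightarrow> card (ksubs U k) = card U choose k"
  unfolding ksubs_def by (rule n_subsets)

lemma card_ksubs_prescribed:
  assumes "finite U" "C \<subseteq> U" "B \<subseteq> C" "card B \<le> k"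
  shows "card {R \<in> ksubs U k. R \<inter> C = B} = (card U - card C) choose (k - card B)"
proof -
  have fin: "finite C" "finite B" using assms finite_subset by metis+
  have "bij_betw (\<lambda>D. D \<union> B) (ksubs (U - C) (k - card B)) {R \<in> ksubs U k. R \<inter> C = B}"
  proof (rule bij_betw_byWitness[where f' = "\<lambda>R. R - C"])
    show "\<forall>D\<in>ksubs (U - C) (k - card B). D \<union> B - C = D"
      using assms unfolding ksubs_def by auto
    show "\<forall>R\<in>{R \<in> ksubs U k. R \<inter> C = B}. R - C \<union> B = R" by auto
    show "(\<lambda>D. D \<union> B) ` ksubs (U - C) (k - card B) \<subseteq> {R \<in> ksubs U k. R \<inter> C = B}"
    proof (rule image_subsetI)
      fix D assume D: "D \<in> ksubs (U - C) (k - card B)"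
      then have "finite D" using assms(1) unfolding ksubs_def by (auto intro: finite_subset)
      moreover have "D \<inter> B = {}" using D assms unfolding ksubs_def by auto
      ultimately have "card (D \<union> B) = k"
        using D assms fin unfolding ksubs_def by (simp add: card_Un_disjoint)
      then show "D \<union> B \<in> {R \<in> ksubs U k. R \<inter> C = B}"
        using D assms unfolding ksubs_def by auto
    qed
    show "(\<lambda>R. R - C) ` {R \<in> ksubs U k. R \<inter> C = B} \<subseteq> ksubs (U - C) (k - card B)"
    proof (rule image_subsetI)
      fix R assume R: "R \<in> {R \<in> ksubs U k. R \<inter> C = B}"
      then have "finite R" using assms(1) unfolding ksubs_def by (auto intro: finite_subset)
      then have "card (R - C) = k - card B"
        using R unfolding ksubs_def by (auto simp: card_Diff_subset_Int)
      then show "R - C \<in> ksubs (U - C) (k - card B)" using R unfolding ksubs_def by auto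
    qed
  qed
  then show ?thesis
    using assms card_ksubs[of "U - C" "k - card B"] bij_betw_same_card card_Diff_subset[OF fin(1) assms(2)]
    by fastforce
qed

lemma card_ksubs_superset:
  assumes "finite U" "S \<subseteq> U" "card S \<le> k"
  shows "card {R \<in> ksubs U k. S \<subseteq> R} = (card U - card S) choose (k - card S)"
proof -
  have "{R \<in> ksubs U k. S \<subseteq> R} = {R \<in> ksubs U k. R \<inter> S = S}" by auto
  then show ?thesis using card_ksubs_prescribed[OF assms(1,2) subset_refl assms(3)] by simp
qed

text \<open>Cauchy-Schwarz against the constant function 1, read off from the nonnegative double sum
  of squared differences.\<close>

lemma sum_square_le_card_times:
  fixes x :: "'a \<Rightarrow> real"
  assumes "finite I"
  shows "(\<Sum>i\<in>I. x i)\<^sup>2 \<le> card I * (\<Sum>i\<in>I. (x i)\<^sup>2)"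
proof -
  have "0 \<le> (\<Sum>i\<in>I. \<Sum>j\<in>I. (x i - x j)\<^sup>2)" by (intro sum_nonneg) auto
  also have "\<dots> = (\<Sum>i\<in>I. \<Sum>j\<in>I. ((x i)\<^sup>2 + (x j)\<^sup>2 - 2 * (x i * x j)))"
    by (simp add: power2_diff algebra_simps)
  also have "\<dots> = 2 * (card I * (\<Sum>i\<in>I. (x i)\<^sup>2)) - 2 * (\<Sum>i\<in>I. x i)\<^sup>2"
    by (simp add: sum.distrib sum_subtractf sum_product power2_eq_square sum_distrib_left[symmetric])
  finally show ?thesis by simp
qed

text \<open>Later \<open>U\<close> consists of the nonidentity elements of a group, \<open>f\<close>
  is an automorphism of prime order and \<open>C\<close> is the set of its nonidentity fixed
  points.\<close>

locale prime_period_map =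
  fixes U :: "'a set" and f :: "'a \<Rightarrow> 'a" and p :: nat and C :: "'a set"
  assumes finU: "finite U" and imgU: "f ` U = U" and prime_p: "Factorial_Ring.prime p"
    and period: "\<And>x. x \<in> U \<Longrightarrow> (f ^^ p) x = x"
    and C_eq: "C = {x \<in> U. f x = x}"
begin

definition inv_sets :: "nat \<Rightarrow> 'a set set" where
  "inv_sets k = {R \<in> ksubs U k. f ` R = R}"

lemma C_sub: "C \<subseteq> U" and finC: "finite C"
  using C_eq finU by auto

lemma inv_square:
  "(card {R \<in> inv_sets k. R \<inter> C = B})\<^sup>2 \<le> card {R \<in> ksubs U k. R \<inter> C = B}"
proof -
  have "{R \<in> inv_sets k. R \<inter> C = B} = {R. R \<subseteq> U \<and> card R = k \<and> f ` R = R \<and> R \<inter> C = B}"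
    "{R \<in> ksubs U k. R \<inter> C = B} = {R. R \<subseteq> U \<and> card R = k \<and> R \<inter> C = B}"
    unfolding inv_sets_def ksubs_def by blast+
  then show ?thesis
    using card_invariant_square_le[OF finU imgU prime_p period C_eq, of k B] by (simp only:)
qed

lemma ksubs_split:
  fixes h :: "'a set \<Rightarrow> real"
  assumes "K \<subseteq> ksubs U k"
  shows "(\<Sum>R\<in>K. h R) = (\<Sum>B\<in>Pow C. \<Sum>R\<in>{R \<in> K. R \<inter> C = B}. h R)"
proof (rule sum.group[symmetric])
  show "finite K" using assms finite_ksubs[OF finU] by (rule finite_subset)
  show "finite (Pow C)" using finC by simp
  show "(\<lambda>R. R \<inter> C) ` K \<subseteq> Pow C" by blast
qed

lemma inv_split: "real (card (inv_sets k)) = (\<Sum>B\<in>Pow C. real (card {R \<in> inv_sets k. R \<inter> C = B}))"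
proof -
  have "inv_sets k \<subseteq> ksubs U k" unfolding inv_sets_def by blast
  from ksubs_split[OF this, of "\<lambda>_. 1"] show ?thesis by simp
qed

text \<open>There are \<open>2 ^ card C\<close> possible traces on \<open>C\<close>. Cauchy-Schwarz
  over them reduces the claim to the square bound for each single trace.\<close>

lemma card_inv_sets_square_le:
  "(card (inv_sets k))\<^sup>2 \<le> 2 ^ card C * (card U choose k)"
proof -
  have sq: "(real (card {R \<in> inv_sets k. R \<inter> C = B}))\<^sup>2 \<le> real (card {R \<in> ksubs U k. R \<inter> C = B})" for B
    using of_nat_mono[OF inv_square[of k B], where 'a = real] by (simp only: of_nat_power)
  have "(real (card (inv_sets k)))\<^sup>2
      \<le> card (Pow C) * (\<Sum>B\<in>Pow C. (real (card {R \<in> inv_sets k. R \<inter> C = B}))\<^sup>2)"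
    unfolding inv_split using finC by (intro sum_square_le_card_times) auto
  also have "\<dots> \<le> card (Pow C) * (\<Sum>B\<in>Pow C. real (card {R \<in> ksubs U k. R \<inter> C = B}))"
    using sq by (intro mult_left_mono sum_mono) auto
  also have "(\<Sum>B\<in>Pow C. real (card {R \<in> ksubs U k. R \<inter> C = B})) = real (card (ksubs U k))"
    using ksubs_split[of "ksubs U k" k "\<lambda>_. 1"] by simp
  finally show ?thesis
    using card_ksubs[OF finU, of k] finC
    by (simp add: card_Pow) (metis (mono_tags, lifting) of_nat_le_iff of_nat_mult of_nat_numeral of_nat_power)
qed

text \<open>Let N be the number of all sets with trace \<open>B\<close>, and w the number of their
  points outside \<open>C\<close>. At most sqrt N of them are invariant, and the hypothesis says
  that sqrt N is at most N times \<open>g ^ min w k0\<close>. So the invariant sets may be charged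
  to all sets, each point outside \<open>C\<close> costing a factor \<open>g\<close>, up to
  \<open>k0\<close> such points.\<close>

lemma card_inv_sets_le_sum:
  fixes g :: real
  assumes g: "0 \<le> g" and k0: "\<And>w. w \<le> k \<Longrightarrow> 1 \<le> real ((card U - card C) choose w) * g ^ (2 * min w k0)"
  shows "real (card (inv_sets k)) \<le> (\<Sum>R\<in>ksubs U k. g ^ min (card (R - C)) k0)"
proof -
  have "real (card {R \<in> inv_sets k. R \<inter> C = B})
      \<le> (\<Sum>R\<in>{R \<in> ksubs U k. R \<inter> C = B}. g ^ min (card (R - C)) k0)" if B: "B \<in> Pow C" for B
  proof (cases "card B \<le> k")
    case True
    let ?i = "real (card {R \<in> inv_sets k. R \<inter> C = B})"
    let ?N = "real (card {R \<in> ksubs U k. R \<inter> C = B})"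
    define w where "w = k - card B"
    have N: "?N = real ((card U - card C) choose w)"
      unfolding w_def using card_ksubs_prescribed[OF finU C_sub, of B k] B True by simp
    have w: "card (R - C) = w" if "R \<in> ksubs U k" "R \<inter> C = B" for R
    proof -
      have "finite R" using that finU unfolding ksubs_def by (auto intro: finite_subset)
      then show ?thesis using that unfolding ksubs_def w_def by (auto simp: card_Diff_subset_Int)
    qed
    have "?i\<^sup>2 \<le> ?N" using of_nat_mono[OF inv_square[of k B], where 'a = real] by (simp only: of_nat_power)
    also have "\<dots> \<le> ?N * (?N * g ^ (2 * min w k0))"
      using k0[of w] unfolding N w_def
      by (metis diff_le_self mult.right_neutral mult_left_mono of_nat_0_le_iff)
    also have "\<dots> = (?N * g ^ min w k0)\<^sup>2"
      by (simp add: power2_eq_square power_mult mult_ac)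
         (simp add: power_mult_distrib power2_eq_square)
    finally have "?i \<le> ?N * g ^ min w k0" using g by (intro power2_le_imp_le[of ?i]) auto
    also have "\<dots> = (\<Sum>R\<in>{R \<in> ksubs U k. R \<inter> C = B}. g ^ min (card (R - C)) k0)"
      using w by simp
    finally show ?thesis .
  next
    case False
    have "{R \<in> inv_sets k. R \<inter> C = B} = {}"
    proof (rule ccontr)
      assume "{R \<in> inv_sets k. R \<inter> C = B} \<noteq> {}"
      then obtain R where "R \<in> ksubs U k" "R \<inter> C = B" unfolding inv_sets_def by auto
      moreover from this have "finite R" using finU finite_subset unfolding ksubs_def by blast
      ultimately have "card B \<le> k" using card_mono[of R B] unfolding ksubs_def by auto
      then show False using False by simp
    qed
    then have "card {R \<in> inv_sets k. R \<inter> C = B} = 0" by (simp only: card.empty)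
    then show ?thesis using g by (simp add: sum_nonneg)
  qed
  then have "real (card (inv_sets k)) \<le> (\<Sum>B\<in>Pow C. \<Sum>R\<in>{R \<in> ksubs U k. R \<inter> C = B}. g ^ min (card (R - C)) k0)"
    unfolding inv_split by (rule sum_mono)
  then show ?thesis using ksubs_split[of "ksubs U k" k] by simp
qed

end

text \<open>A \<open>k0\<close>-subset S of R has at most \<open>min (card (R - C)) k0\<close>
  points outside \<open>C\<close>, so as \<open>g\<close> is at most 1 the weight of R is at most
  that of each of its samples. Counting the pairs of S inside R in both orders passes from
  \<open>k\<close>-sets to \<open>k0\<close>-sets.\<close>

lemma sum_ksubs_average:
  fixes g :: real
  assumes U: "finite U" and k: "k0 \<le> k" "k \<le> card U" and g: "0 \<le> g" "g \<le> 1"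
  shows "(\<Sum>R\<in>ksubs U k. g ^ min (card (R - C)) k0) * (card U choose k0)
    \<le> (card U choose k) * (\<Sum>S\<in>ksubs U k0. g ^ card (S - C))"
proof -
  let ?L = "\<Sum>R\<in>ksubs U k. g ^ min (card (R - C)) k0"
  let ?S = "\<Sum>S\<in>ksubs U k0. g ^ card (S - C)"
  have "(k choose k0) * ?L = (\<Sum>R\<in>ksubs U k. \<Sum>S\<in>ksubs R k0. g ^ min (card (R - C)) k0)"
    unfolding sum_distrib_left
  proof (rule sum.cong[OF refl])
    fix R assume "R \<in> ksubs U k"
    then have "finite R" "card R = k" using U unfolding ksubs_def by (auto intro: finite_subset)
    then show "(k choose k0) * g ^ min (card (R - C)) k0 = (\<Sum>S\<in>ksubs R k0. g ^ min (card (R - C)) k0)"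
      by (simp add: card_ksubs)
  qed
  also have "\<dots> \<le> (\<Sum>R\<in>ksubs U k. \<Sum>S\<in>ksubs R k0. g ^ card (S - C))"
  proof (intro sum_mono)
    fix R S assume R: "R \<in> ksubs U k" and S: "S \<in> ksubs R k0"
    have f: "finite R" "finite S" using R S U unfolding ksubs_def by (auto intro: finite_subset)
    have "card (S - C) \<le> card (R - C)" "card (S - C) \<le> k0"
      using S f unfolding ksubs_def by (auto intro!: card_mono)
    then show "g ^ min (card (R - C)) k0 \<le> g ^ card (S - C)" using g by (intro power_decreasing) auto
  qed
  also have "\<dots> = (\<Sum>R\<in>ksubs U k. \<Sum>S\<in>{S \<in> ksubs U k0. S \<subseteq> R}. g ^ card (S - C))"
    by (intro sum.cong) (auto simp: ksubs_def)
  also have "\<dots> = (\<Sum>S\<in>ksubs U k0. \<Sum>R\<in>{R \<in> ksubs U k. S \<subseteq> R}. g ^ card (S - C))"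
    using U by (intro sum.swap_restrict finite_ksubs)
  also have "\<dots> = (\<Sum>S\<in>ksubs U k0. ((card U - k0) choose (k - k0)) * g ^ card (S - C))"
  proof (rule sum.cong[OF refl])
    fix S assume "S \<in> ksubs U k0"
    then show "(\<Sum>R\<in>{R \<in> ksubs U k. S \<subseteq> R}. g ^ card (S - C))
        = ((card U - k0) choose (k - k0)) * g ^ card (S - C)"
      using card_ksubs_superset[OF U, of S k] k unfolding ksubs_def by simp
  qed
  also have "\<dots> = ((card U - k0) choose (k - k0)) * ?S" by (simp add: sum_distrib_left)
  finally have 1: "(k choose k0) * ?L \<le> ((card U - k0) choose (k - k0)) * ?S" .
  have cm: "real (card U choose k) * (k choose k0) = (card U choose k0) * ((card U - k0) choose (k - k0))"
    using choose_mult[OF k] by (metis of_nat_mult)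
  have "(k choose k0) * (?L * (card U choose k0)) \<le> ((card U - k0) choose (k - k0)) * ?S * (card U choose k0)"
    using 1 by (simp add: mult_right_mono flip: mult.assoc)
  also have "\<dots> = (k choose k0) * ((card U choose k) * ?S)"
    using cm by (simp add: mult_ac)
  finally show ?thesis using k by (simp add: mult_le_cancel_left)
qed

text \<open>Drawing without replacement: each point drawn from a part of density at most
  \<open>q\<close> leaves a part whose density is again at most \<open>q\<close>, because
  \<open>q\<close> is at most 1.\<close>

lemma choose_le_power_times_choose:
  fixes q :: real
  assumes "a \<le> x" "real a \<le> q * real x" "0 \<le> q" "q \<le> 1"
  shows "real (a choose v) \<le> q ^ v * real (x choose v)"
  using assms(1,2)
proof (induction v arbitrary: a x)
  case (Suc v)
  show ?case
  proof (cases a)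
    case 0
    then show ?thesis using assms by simp
  next
    case a: (Suc a')
    then obtain x' where x: "x = Suc x'" using Suc.prems(1) by (cases x) auto
    have "real a' \<le> q * real x'" using Suc.prems(2) assms(4) unfolding a x by (simp add: algebra_simps)
    then have IH: "real (a' choose v) \<le> q ^ v * real (x' choose v)" using Suc a x by simp
    have "real (Suc v) * real (a choose Suc v) = real (Suc a') * real (a' choose v)"
      unfolding a by (metis Suc_times_binomial_eq mult.commute of_nat_mult)
    also have "\<dots> \<le> (q * real (Suc x')) * (q ^ v * real (x' choose v))"
      using Suc.prems(2) IH assms(3) unfolding a x by (intro mult_mono) auto
    also have "\<dots> = q ^ Suc v * (real (Suc x') * real (x' choose v))" by simp
    also have "real (Suc x') * real (x' choose v) = real (Suc v) * real (x choose Suc v)"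
      unfolding x by (metis Suc_times_binomial_eq mult.commute of_nat_mult)
    finally have "real (Suc v) * real (a choose Suc v) \<le> real (Suc v) * (q ^ Suc v * real (x choose Suc v))"
      by (simp add: mult_ac)
    then show ?thesis by (simp only: mult_le_cancel_left_pos of_nat_0_less_iff zero_less_Suc)
  qed
qed simp

text \<open>For a random \<open>t\<close>-set V, each point costs at most \<open>q\<close> for lying
  in \<open>A\<close> plus \<open>g\<close> for lying outside. To avoid fixing the exact
  intersection with \<open>A\<close>, the term for \<open>V \<inter> A\<close> is bounded by the sum
  over all subsets W of it; after swapping the sums this becomes the binomial expansion of
  \<open>(q + g) ^ t\<close>.\<close>

lemma sum_ksubs_power_le:
  fixes g q :: real
  assumes Y: "finite Y" "A \<subseteq> Y" and t: "t \<le> card Y" and g: "0 \<le> g"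
    and q: "real (card A) \<le> q * real (card Y)" "0 \<le> q" "q \<le> 1"
  shows "(\<Sum>V\<in>ksubs Y t. g ^ card (V - A)) \<le> (card Y choose t) * (q + g) ^ t"
proof -
  have finA: "finite A" using Y finite_subset by blast
  have "(\<Sum>V\<in>ksubs Y t. g ^ card (V - A)) \<le> (\<Sum>V\<in>ksubs Y t. \<Sum>W\<in>{W \<in> Pow A. W \<subseteq> V}. g ^ (t - card W))"
  proof (rule sum_mono)
    fix V assume V: "V \<in> ksubs Y t"
    then have f: "finite V" using Y unfolding ksubs_def by (auto intro: finite_subset)
    have "card (V - A) = t - card (V \<inter> A)" using V f unfolding ksubs_def by (auto simp: card_Diff_subset_Int)
    then have "g ^ card (V - A) = (\<Sum>W\<in>{V \<inter> A}. g ^ (t - card W))" by simp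
    also have "\<dots> \<le> (\<Sum>W\<in>{W \<in> Pow A. W \<subseteq> V}. g ^ (t - card W))"
      using finA g by (intro sum_mono2) auto
    finally show "g ^ card (V - A) \<le> (\<Sum>W\<in>{W \<in> Pow A. W \<subseteq> V}. g ^ (t - card W))" .
  qed
  also have "\<dots> = (\<Sum>W\<in>Pow A. \<Sum>V\<in>{V \<in> ksubs Y t. W \<subseteq> V}. g ^ (t - card W))"
    using Y finA by (intro sum.swap_restrict finite_ksubs) auto
  also have "\<dots> = (\<Sum>W\<in>Pow A. if card W \<le> t then ((card Y - card W) choose (t - card W)) * g ^ (t - card W) else 0)"
  proof (rule sum.cong[OF refl])
    fix W assume W: "W \<in> Pow A"
    show "(\<Sum>V\<in>{V \<in> ksubs Y t. W \<subseteq> V}. g ^ (t - card W))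
        = (if card W \<le> t then ((card Y - card W) choose (t - card W)) * g ^ (t - card W) else 0)"
    proof (cases "card W \<le> t")
      case True
      have "W \<subseteq> Y" using W Y by auto
      then show ?thesis using card_ksubs_superset[OF Y(1) _ True] True by simp
    next
      case False
      have "{V \<in> ksubs Y t. W \<subseteq> V} = {}"
        using False Y card_mono finite_subset unfolding ksubs_def by blast
      then show ?thesis using False by (simp only: sum.empty if_False)
    qed
  qed
  also have "\<dots> = (\<Sum>W\<in>{W \<in> Pow A. card W \<le> t}. ((card Y - card W) choose (t - card W)) * g ^ (t - card W))"
    using finA by (intro sum.inter_filter[symmetric]) auto
  also have "\<dots> = (\<Sum>v\<in>{..t}. \<Sum>W\<in>{W \<in> {W \<in> Pow A. card W \<le> t}. card W = v}. ((card Y - card W) choose (t - card W)) * g ^ (t - card W))"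
    using finA by (intro sum.group[symmetric]) auto
  also have "\<dots> = (\<Sum>v\<le>t. (card A choose v) * (((card Y - v) choose (t - v)) * g ^ (t - v)))"
  proof (rule sum.cong[OF refl])
    fix v assume "v \<in> {..t}"
    then have "{W \<in> {W \<in> Pow A. card W \<le> t}. card W = v} = ksubs A v" unfolding ksubs_def by auto
    moreover have "(\<Sum>W\<in>ksubs A v. ((card Y - card W) choose (t - card W)) * g ^ (t - card W))
      = (\<Sum>W\<in>ksubs A v. ((card Y - v) choose (t - v)) * g ^ (t - v))"
      by (intro sum.cong) (auto simp: ksubs_def)
    ultimately show "(\<Sum>W\<in>{W \<in> {W \<in> Pow A. card W \<le> t}. card W = v}. ((card Y - card W) choose (t - card W)) * g ^ (t - card W))
      = (card A choose v) * (((card Y - v) choose (t - v)) * g ^ (t - v))"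
      using card_ksubs[OF finA, of v] by simp
  qed
  also have "\<dots> \<le> (\<Sum>v\<le>t. (card Y choose t) * ((t choose v) * q ^ v * g ^ (t - v)))"
  proof (rule sum_mono)
    fix v assume v: "v \<in> {..t}"
    have "real (card A choose v) * (((card Y - v) choose (t - v)) * g ^ (t - v))
      \<le> (q ^ v * real (card Y choose v)) * (((card Y - v) choose (t - v)) * g ^ (t - v))"
      using choose_le_power_times_choose[OF _ q] card_mono[OF Y] g by (intro mult_right_mono) auto
    also have "\<dots> = real ((card Y choose v) * ((card Y - v) choose (t - v))) * (q ^ v * g ^ (t - v))" by simp
    also have "(card Y choose v) * ((card Y - v) choose (t - v)) = (card Y choose t) * (t choose v)"
      using choose_mult[of v t "card Y"] v t by simp
    finally show "real (card A choose v) * (((card Y - v) choose (t - v)) * g ^ (t - v))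
      \<le> (card Y choose t) * ((t choose v) * q ^ v * g ^ (t - v))" by (simp add: mult_ac)
  qed
  also have "\<dots> = (card Y choose t) * (q + g) ^ t"
    unfolding binomial_ring[of q g t] by (simp add: sum_distrib_left)
  finally show ?thesis .
qed

section \<open>Binomial coefficients large enough to pay for the points outside
  \<open>C\<close>\<close>

lemma two_pow_fact_le: "2 ^ w * fact w \<le> (w + 1) ^ w" for w :: nat
proof (induction w)
  case (Suc w)
  have "2 * (w + 1) ^ Suc w \<le> (w + 2) ^ Suc w"
  proof -
    \<comment> \<open>Bernoulli's inequality bounds the power of \<open>1 + 1 / (real w + 1)\<close>
      below by 2.\<close>
    have "real 2 * (real w + 1) ^ Suc w \<le> (1 + 1 / (real w + 1)) ^ Suc w * (real w + 1) ^ Suc w"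
      using Bernoulli_inequality[of "1 / (real w + 1)" "Suc w"]
      by (intro mult_right_mono) (auto simp: field_simps)
    also have "\<dots> = ((1 + 1 / (real w + 1)) * (real w + 1)) ^ Suc w"
      by (rule power_mult_distrib[symmetric])
    also have "(1 + 1 / (real w + 1)) * (real w + 1) = real w + 2" by (simp add: field_simps)
    finally have "real (2 * (w + 1) ^ Suc w) \<le> real ((w + 2) ^ Suc w)"
      by (simp only: of_nat_mult of_nat_power of_nat_add of_nat_1 of_nat_numeral)
    then show ?thesis by (simp only: of_nat_le_iff)
  qed
  moreover have "2 ^ Suc w * fact (Suc w) = (2 * (w + 1)) * (2 ^ w * fact w)"
    by (simp add: algebra_simps)
  moreover have "(2 * (w + 1)) * (2 ^ w * fact w) \<le> (2 * (w + 1)) * (w + 1) ^ w"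
    using Suc by (intro mult_left_mono) auto
  ultimately show ?case by (simp add: mult_ac)
qed simp

lemma pow_le_fact_choose: "(n - w) ^ w \<le> fact w * (n choose w)" for n w :: nat
proof (induction w arbitrary: n)
  case (Suc w)
  show ?case
  proof (cases n)
    case n: (Suc m)
    have "(n - Suc w) ^ Suc w \<le> Suc m * (m - w) ^ w" 
      unfolding n diff_Suc_Suc power_Suc by (intro mult_right_mono) auto
    also have "\<dots> \<le> Suc m * (fact w * (m choose w))" using Suc by (intro mult_left_mono) auto
    also have "\<dots> = fact w * (Suc m * (m choose w))" by (simp only: mult.left_commute)
    also have "\<dots> = fact (Suc w) * (n choose Suc w)" 
      unfolding n Suc_times_binomial_eq by (simp add: algebra_simps)
    finally show ?thesis .
  qed simp
qed simp

text \<open>For v at most \<open>k0\<close> the two preceding estimates bound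
  \<open>N choose v\<close> below by the v-th power of 2 * (N - v) / (v + 1), and the hypothesis
  makes this times \<open>g\<^sup>2\<close> at least 1. Beyond \<open>k0\<close> the exponent is
  frozen, and \<open>N choose w\<close> is at least \<open>N choose k0\<close> because
  \<open>w\<close> lies between \<open>k0\<close> and \<open>N - k0\<close>.\<close>

lemma choose_times_power_ge_one:
  fixes g :: real
  assumes g: "0 \<le> g" "real k0 + 1 \<le> 2 * (real N - real k0) * g\<^sup>2" and w: "w + k0 \<le> N"
  shows "1 \<le> real (N choose w) * g ^ (2 * min w k0)"
proof -
  have le: "1 \<le> real (N choose v) * g ^ (2 * v)" if v: "v \<le> k0" for v
  proof -
    have Nv: "k0 < N"
    proof (rule ccontr)
      assume "\<not> k0 < N"
      then have "2 * (real N - real k0) \<le> 0" by simp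
      then have "2 * (real N - real k0) * g\<^sup>2 \<le> 0" by (rule mult_nonpos_nonneg) simp
      then show False using g by linarith
    qed
    have "real v + 1 \<le> 2 * real (N - v) * g\<^sup>2"
    proof -
      have "2 * (real N - real k0) * g\<^sup>2 \<le> 2 * (real N - real v) * g\<^sup>2"
        using v by (intro mult_right_mono) auto
      then show ?thesis using g v Nv by (simp add: of_nat_diff)
    qed
    then have "(real v + 1) ^ v \<le> (2 * real (N - v) * g\<^sup>2) ^ v" by (rule power_mono) simp
    also have "\<dots> = 2 ^ v * real ((N - v) ^ v) * g ^ (2 * v)" by (simp add: power_mult_distrib power_mult)
    also have "\<dots> \<le> 2 ^ v * real (fact v * (N choose v)) * g ^ (2 * v)"
      using g(1) of_nat_mono[OF pow_le_fact_choose[of N v]]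
      by (intro mult_right_mono mult_left_mono zero_le_power) auto
    also have "\<dots> = real (2 ^ v * fact v) * (real (N choose v) * g ^ (2 * v))" by simp
    also have "\<dots> \<le> real ((v + 1) ^ v) * (real (N choose v) * g ^ (2 * v))"
      using g(1) of_nat_mono[OF two_pow_fact_le[of v]]
      by (intro mult_right_mono mult_nonneg_nonneg zero_le_power) auto
    finally have "(real v + 1) ^ v * 1 \<le> (real v + 1) ^ v * (real (N choose v) * g ^ (2 * v))"
      by (simp add: add_ac)
    moreover have "0 < (real v + 1) ^ v" by simp
    ultimately show ?thesis by (simp only: mult_le_cancel_left_pos)
  qed
  show ?thesis
  proof (cases "w \<le> k0")
    case True
    then show ?thesis using le by simp
  next
    case False
    have "N choose k0 \<le> N choose w"
    proof (cases "2 * w \<le> N")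
      case True
      then show ?thesis using False by (intro binomial_mono) auto
    next
      case False
      then have "N choose k0 \<le> N choose (N - w)" using w by (intro binomial_mono) auto
      then show ?thesis using w by (simp add: binomial_symmetric[of w N])
    qed
    then have "real (N choose k0) * g ^ (2 * k0) \<le> real (N choose w) * g ^ (2 * k0)"
      using g by (intro mult_right_mono) auto
    then show ?thesis using le[of k0] False by simp
  qed
qed

section \<open>Generation and subgroup indices\<close>

text \<open>Elements of \<open>Bij S\<close> are undefined outside \<open>S\<close>; setting them to
  the identity there gives permutations of \<open>S\<close>.\<close>

lemma card_Bij_le:
  assumes "finite S"
  shows "card (Bij S) \<le> fact (card S)" and "finite (Bij S)"
proof -
  let ?e = "\<lambda>f x. if x \<in> S then f x else x"
  have inj: "inj_on ?e (Bij S)"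
  proof (rule inj_onI)
    fix f g assume f: "f \<in> Bij S" and g: "g \<in> Bij S" and e: "?e f = ?e g"
    show "f = g"
    proof (rule extensionalityI[of _ S])
      show "f \<in> extensional S" "g \<in> extensional S" using f g Bij_imp_extensional by auto
      show "f x = g x" if "x \<in> S" for x using fun_cong[OF e, of x] that by simp
    qed
  qed
  have img: "?e ` Bij S \<subseteq> {p. p permutes S}"
  proof (rule image_subsetI, rule CollectI, rule bij_imp_permutes)
    fix f assume "f \<in> Bij S"
    then have "bij_betw f S S" unfolding Bij_def by simp
    then show "bij_betw (?e f) S S" by (rule bij_betw_cong[THEN iffD1, rotated]) simp
  qed simp
  have fin: "finite {p. p permutes S}" using finite_permutations[OF assms] .
  show "card (Bij S) \<le> fact (card S)"
    using card_inj_on_le[OF inj img fin] card_permutations[OF refl assms] by simp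
  show "finite (Bij S)" using inj_on_finite[OF inj img fin] .
qed

section \<open>Generating sets and the automorphisms determined by them\<close>

context group
begin

lemma card_subgroup_double:
  assumes H: "subgroup H G" and K: "subgroup K G" "H \<subseteq> K" "finite K" and x: "x \<in> K" "x \<notin> H"
  shows "2 * card H \<le> card K"
proof -
  have xc: "x \<in> carrier G" using x K subgroup.mem_carrier by metis
  have HG: "H \<subseteq> carrier G" using H subgroup.subset by auto
  have sub: "H #> x \<subseteq> K" using K x unfolding r_coset_def by (auto intro: subgroup.m_closed)
  have disj: "H \<inter> (H #> x) = {}"
  proof (rule ccontr)
    assume "H \<inter> (H #> x) \<noteq> {}"
    then obtain h where h: "h \<in> H" "h \<otimes> x \<in> H" unfolding r_coset_def by auto
    then have "inv h \<otimes> (h \<otimes> x) \<in> H" using H by (auto intro: subgroup.m_closed subgroup.m_inv_closed)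
    then have "x \<in> H" using h HG xc by (metis inv_solve_left' m_closed subsetD)
    then show False using x by simp
  qed
  have "H #> x \<in> rcosets H" using xc unfolding RCOSETS_def by blast
  then have "card (H #> x) = card H" using card_rcosets_equal[OF _ HG] by metis
  then have "2 * card H = card (H \<union> (H #> x))"
    using K(2,3) sub disj finite_subset card_Un_disjoint[of H "H #> x"] by (metis mult_2)
  also have "\<dots> \<le> card K" using K sub by (intro card_mono) auto
  finally show ?thesis .
qed

lemma card_subgroup_dvd:
  assumes "subgroup H G" "subgroup K G" "H \<subseteq> K"
  shows "card H dvd card K"
proof -
  interpret K: group "G\<lparr>carrier := K\<rparr>" using assms(2) subgroup.subgroup_is_group is_group by blast
  have "card (rcosets\<^bsub>G\<lparr>carrier := K\<rparr>\<^esub> H) * card H = order (G\<lparr>carrier := K\<rparr>)"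
    using K.lagrange[OF subgroup_incl[OF assms]] .
  then show ?thesis by (simp add: order_def) (metis dvd_triv_right)
qed

text \<open>Greedy choice: an element is kept only if it is not generated by those kept before, and
  then it at least doubles the generated subgroup.\<close>

lemma generating_subset_exists:
  assumes fin: "finite (carrier G)" and F: "F \<subseteq> carrier G"
  shows "\<exists>B \<subseteq> F. F \<subseteq> generate G B \<and> 2 ^ card B \<le> card (generate G B)"
proof -
  have "finite F" using fin F finite_subset by blast
  then show ?thesis using F
  proof (induction F rule: finite_induct)
    case empty
    have "card (generate G {}) = 1" using generate_empty by simp
    then show ?case by auto
  next
    case (insert x F)
    then obtain B where B: "B \<subseteq> F" "F \<subseteq> generate G B" "2 ^ card B \<le> card (generate G B)" by auto
    have Bc: "B \<subseteq> carrier G" using B insert by auto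
    show ?case
    proof (cases "x \<in> generate G B")
      case True
      then show ?thesis using B by blast
    next
      case False
      have finB: "finite B" using B insert finite_subset by blast
      have sub: "generate G B \<subseteq> generate G (insert x B)" by (rule mono_generate) auto
      have xin: "x \<in> generate G (insert x B)" by (rule generate.incl) simp
      have fing: "finite (generate G (insert x B))"
        using fin generate_incl[of "insert x B"] Bc insert.prems finite_subset by fastforce
      have "2 * card (generate G B) \<le> card (generate G (insert x B))"
        using card_subgroup_double[OF generate_is_subgroup[OF Bc] generate_is_subgroup sub fing xin False]
          Bc insert.prems by auto
      then have "2 ^ card (insert x B) \<le> card (generate G (insert x B))"
        using B(3) finB B(1) insert.hyps by (simp add: card_insert_if)
      then show ?thesis using B sub xin by (intro exI[of _ "insert x B"]) auto
    qed
  qed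
qed

text \<open>Each added element at least doubles the subgroup. A subgroup of order above
  \<open>order G / m\<close> is the whole group by the index hypothesis, so the last factor
  \<open>m\<close> needs no generators.\<close>

lemma extend_to_generating_set:
  assumes fin: "finite (carrier G)"
    and idx: "\<And>H. subgroup H G \<Longrightarrow> H \<noteq> carrier G \<Longrightarrow> m * card H \<le> order G"
  shows "subgroup K G \<Longrightarrow> order G < m * 2 ^ s * card K \<Longrightarrow>
    \<exists>Y. Y \<subseteq> carrier G \<and> card Y \<le> s \<and> generate G (K \<union> Y) = carrier G"
proof (induction s arbitrary: K)
  case 0
  then have "K = carrier G" using idx[of K] by fastforce
  moreover have "generate G (carrier G) = carrier G"
    using generate_incl[of "carrier G"] generate.incl[of _ "carrier G" G] by blast
  ultimately show ?case by (intro exI[of _ "{}"]) simp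
next
  case (Suc s)
  have Kc: "K \<subseteq> carrier G" using Suc.prems subgroup.subset by auto
  show ?case
  proof (cases "K = carrier G")
    case True
    then have "generate G K = carrier G"
      using generate_incl[of "carrier G"] generate.incl[of _ "carrier G" G] by blast
    then show ?thesis by (intro exI[of _ "{}"]) simp
  next
    case False
    then obtain x where x: "x \<in> carrier G" "x \<notin> K" using Kc by auto
    define L where "L = generate G (insert x K)"
    have Lsub: "subgroup L G" unfolding L_def using x Kc by (intro generate_is_subgroup) auto
    have LK: "insert x K \<subseteq> L" unfolding L_def by (auto intro: generate.incl)
    have Lc: "L \<subseteq> carrier G" using Lsub subgroup.subset by auto
    have "2 * card K \<le> card L"
      using card_subgroup_double[OF Suc.prems(1) Lsub] LK x Lc fin finite_subset by blast
    then have "m * 2 ^ s * (2 * card K) \<le> m * 2 ^ s * card L" by (rule mult_left_mono) simp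
    moreover have "m * 2 ^ Suc s * card K = m * 2 ^ s * (2 * card K)" by simp
    ultimately have "order G < m * 2 ^ s * card L" using Suc.prems(2) by (simp only: order_less_le_trans)
    then obtain Y where Y: "Y \<subseteq> carrier G" "card Y \<le> s" "generate G (L \<union> Y) = carrier G"
      using Suc.IH[OF Lsub] by blast
    have sub: "K \<union> insert x Y \<subseteq> carrier G" using Kc x Y by auto
    have "L \<subseteq> generate G (K \<union> insert x Y)" unfolding L_def by (rule mono_generate) auto
    moreover have "Y \<subseteq> generate G (K \<union> insert x Y)" by (auto intro: generate.incl)
    ultimately have "generate G (L \<union> Y) \<subseteq> generate G (K \<union> insert x Y)"
      using generate_subgroup_incl[OF _ generate_is_subgroup[OF sub]] by auto
    then have "generate G (K \<union> insert x Y) = carrier G" using Y(3) generate_incl[OF sub] by auto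
    moreover have "card (insert x Y) \<le> Suc s" 
      using Y(1,2) fin finite_subset by (fastforce simp: card_insert_if)
    ultimately show ?thesis using sub by (intro exI[of _ "insert x Y"]) auto
  qed
qed

lemma hom_eq_on_generate:
  assumes f: "f \<in> hom G G" and g: "g \<in> hom G G" and A: "A \<subseteq> carrier G"
    and e: "\<And>x. x \<in> A \<Longrightarrow> f x = g x" and x: "x \<in> generate G A"
  shows "f x = g x"
  using x
proof (induction rule: generate.induct)
  case one
  then show ?case using hom_one[OF f is_group is_group] hom_one[OF g is_group is_group] by simp
next
  case (incl h)
  then show ?case using e by simp
next
  case (inv h)
  interpret f: group_hom G G f by (intro group_hom.intro group_hom_axioms.intro f is_group)
  interpret g: group_hom G G g by (intro group_hom.intro group_hom_axioms.intro g is_group)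
  show ?case using inv e[of h] A f.hom_inv g.hom_inv by (metis subsetD)
next
  case (eng h1 h2)
  then have "h1 \<in> carrier G" "h2 \<in> carrier G" using generate_incl[OF A] by auto
  then show ?case using eng hom_mult[OF f] hom_mult[OF g] by simp
qed

lemma finite_auto: "finite (carrier G) \<Longrightarrow> finite (auto G)"
  unfolding auto_def using card_Bij_le(2) by auto

text \<open>An automorphism fixing \<open>K\<close> pointwise is determined by its restriction to
  \<open>Y\<close>; extensionality outside the carrier makes this an equality of functions.\<close>

lemma card_auto_fixing_le:
  assumes fin: "finite (carrier G)" and K: "K \<subseteq> carrier G" and Y: "Y \<subseteq> carrier G"
    and gen: "generate G (K \<union> Y) = carrier G"
  shows "card {f \<in> auto G. \<forall>x\<in>K. f x = x} \<le> order G ^ card Y"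
proof -
  have finY: "finite Y" using fin Y finite_subset by blast
  have "inj_on (\<lambda>f. restrict f Y) {f \<in> auto G. \<forall>x\<in>K. f x = x}"
  proof (rule inj_onI)
    fix f g assume f: "f \<in> {f \<in> auto G. \<forall>x\<in>K. f x = x}" and g: "g \<in> {f \<in> auto G. \<forall>x\<in>K. f x = x}"
      and e: "restrict f Y = restrict g Y"
    have h: "f \<in> hom G G" "g \<in> hom G G" using f g unfolding auto_def by auto
    have ext: "f \<in> extensional (carrier G)" "g \<in> extensional (carrier G)"
      using f g Bij_imp_extensional unfolding auto_def by auto
    have eq: "f x = g x" if "x \<in> K \<union> Y" for x
    proof (cases "x \<in> K")
      case True then show ?thesis using f g by simp
    next
      case False
      then show ?thesis using fun_cong[OF e, of x] that by simp
    qed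
    have "f x = g x" if "x \<in> carrier G" for x
      using hom_eq_on_generate[OF h _ eq, of "K \<union> Y" x] K Y gen that by auto
    then show "f = g" using ext by (rule extensionalityI[rotated -1])
  qed
  moreover have "(\<lambda>f. restrict f Y) ` {f \<in> auto G. \<forall>x\<in>K. f x = x} \<subseteq> (Y \<rightarrow>\<^sub>E carrier G)"
  proof (rule image_subsetI)
    fix f assume "f \<in> {f \<in> auto G. \<forall>x\<in>K. f x = x}"
    then have "f \<in> carrier G \<rightarrow> carrier G" using Bij_imp_funcset unfolding auto_def by blast
    then show "restrict f Y \<in> Y \<rightarrow>\<^sub>E carrier G" using Y by (auto simp: PiE_def)
  qed
  moreover have "finite (Y \<rightarrow>\<^sub>E carrier G)" using finY fin by (intro finite_PiE) auto
  ultimately have "card {f \<in> auto G. \<forall>x\<in>K. f x = x} \<le> card (Y \<rightarrow>\<^sub>E carrier G)" by (rule card_inj_on_le)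
  also have "\<dots> = order G ^ card Y" using finY by (simp add: card_PiE order_def)
  finally show ?thesis .
qed

lemma comm_group_if_generated_by_one:
  assumes "finite (carrier G)" "a \<in> carrier G" "generate G {a} = carrier G"
  shows "comm_group G"
proof (rule group_comm_groupI)
  fix x y assume "x \<in> carrier G" "y \<in> carrier G"
  then obtain i j :: nat where "x = a [^] i" "y = a [^] j"
    using generate_pow_on_finite_carrier[OF assms(1,2)] assms(3) by auto
  then show "x \<otimes> y = y \<otimes> x" using assms(2) by (simp add: nat_pow_mult add.commute)
qed

end

section \<open>Subgroups of small index and two-generated subgroups in simple groups\<close>

context simple_group
begin

text \<open>The group acts on the right cosets of \<open>H\<close>. The kernel is normal and
  contained in the stabiliser \<open>H\<close> of the coset \<open>H\<close>, hence trivial by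
  simplicity, and the action embeds the group into the permutations of the cosets.\<close>

lemma order_le_fact_index:
  assumes fin: "finite (carrier G)" and H: "subgroup H G" "H \<noteq> carrier G"
  shows "order G \<le> fact (card (rcosets H))"
proof -
  define S where "S = rcosets H"
  \<comment> \<open>The inverse makes right multiplication compatible with composition from right to
    left.\<close>
  define \<phi> where "\<phi> g = (\<lambda>M\<in>S. M #> inv g)" for g
  have HG: "H \<subseteq> carrier G" using H subgroup.subset by auto
  have Sc: "M \<subseteq> carrier G" if "M \<in> S" for M
    using that subgroup.rcosets_carrier[OF H(1) is_group] unfolding S_def by auto
  have closed: "M #> g \<in> S" if M: "M \<in> S" and g: "g \<in> carrier G" for M g
  proof -
    obtain a where a: "a \<in> carrier G" "M = H #> a" using M unfolding S_def RCOSETS_def by auto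
    then have "M #> g = H #> (a \<otimes> g)" using coset_mult_assoc[OF HG a(1) g] by simp
    then show ?thesis using a g unfolding S_def RCOSETS_def by auto
  qed
  have finS: "finite S" using fin rcosets_part_G[OF H(1)] unfolding S_def by (metis finite_UnionD)
  have Bij: "\<phi> g \<in> Bij S" if g: "g \<in> carrier G" for g
  proof -
    have "bij_betw (\<phi> g) S S"
    proof (rule bij_betw_byWitness[where f' = "\<lambda>M. M #> g"])
      show "\<forall>M\<in>S. \<phi> g M #> g = M"
        using g Sc unfolding \<phi>_def by (simp add: coset_mult_assoc coset_mult_one)
      show "\<forall>M\<in>S. \<phi> g (M #> g) = M"
        using g Sc closed unfolding \<phi>_def by (simp add: coset_mult_assoc coset_mult_one)
      show "\<phi> g ` S \<subseteq> S" using g closed unfolding \<phi>_def by auto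
      show "(\<lambda>M. M #> g) ` S \<subseteq> S" using g closed by auto
    qed
    then show ?thesis unfolding Bij_def \<phi>_def by simp
  qed
  have hom: "\<phi> \<in> hom G (BijGroup S)"
  proof (rule homI)
    fix g assume "g \<in> carrier G" then show "\<phi> g \<in> carrier (BijGroup S)" using Bij unfolding BijGroup_def by simp
  next
    fix g h assume gh: "g \<in> carrier G" "h \<in> carrier G"
    have "\<phi> (g \<otimes> h) = compose S (\<phi> g) (\<phi> h)"
    proof
      fix M
      show "\<phi> (g \<otimes> h) M = compose S (\<phi> g) (\<phi> h) M"
        using gh Sc closed unfolding \<phi>_def compose_def by (auto simp: inv_mult_group coset_mult_assoc)
    qed
    then show "\<phi> (g \<otimes> h) = \<phi> g \<otimes>\<^bsub>BijGroup S\<^esub> \<phi> h" using gh Bij unfolding BijGroup_def by simp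
  qed
  interpret h: group_hom G "BijGroup S" \<phi>
    by (intro group_hom.intro group_hom_axioms.intro is_group group_BijGroup hom)
  have "kernel G (BijGroup S) \<phi> \<noteq> carrier G"
  proof
    assume ker: "kernel G (BijGroup S) \<phi> = carrier G"
    have "x \<in> H" if x: "x \<in> carrier G" for x
    proof -
      have "inv x \<in> kernel G (BijGroup S) \<phi>" using ker x by simp
      then have e: "\<phi> (inv x) = (\<lambda>M\<in>S. M)" unfolding kernel_def BijGroup_def by simp
      have HS: "H \<in> S" unfolding S_def using subgroup.subgroup_in_rcosets[OF H(1) is_group] .
      have "H #> inv (inv x) = H" using fun_cong[OF e, of H] HS unfolding \<phi>_def by simp
      then show ?thesis using x H coset_join1 by simp
    qed
    then show False using H HG by auto
  qed
  then have "kernel G (BijGroup S) \<phi> = {\<one>}" using no_real_normal_subgroup[OF h.normal_kernel] by auto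
  then have "inj_on \<phi> (carrier G)" by (rule h.trivial_ker_imp_inj)
  moreover have "\<phi> ` carrier G \<subseteq> Bij S" using Bij by auto
  ultimately have "order G \<le> card (Bij S)"
    unfolding order_def using card_inj_on_le card_Bij_le(2)[OF finS] by blast
  then show ?thesis using card_Bij_le(1)[OF finS] unfolding S_def by simp
qed

text \<open>Used with \<open>m = 4\<close> and \<open>m = 5\<close>: indices are at least 5 once the
  order exceeds 24, and at least 6 once it exceeds 120.\<close>

lemma index_ge:
  assumes fin: "finite (carrier G)" and big: "fact m < order G"
    and H: "subgroup H G" "H \<noteq> carrier G"
  shows "Suc m * card H \<le> order G"
proof -
  have "\<not> card (rcosets H) \<le> m"
  proof
    assume "card (rcosets H) \<le> m"
    then have "fact (card (rcosets H)) \<le> (fact m :: nat)" by (rule fact_mono)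
    then show False using order_le_fact_index[OF fin H] big by simp
  qed
  then have "Suc m * card H \<le> card (rcosets H) * card H" by (intro mult_right_mono) auto
  then show ?thesis using lagrange[OF H(1)] by simp
qed

text \<open>A subgroup P of order \<open>p\<close> is not normal, so some g conjugates some h of P
  out of P. As P has prime order, P meets its conjugate by g trivially, and the products of their
  elements are \<open>p\<^sup>2\<close> distinct elements of the subgroup generated by h and
  g.\<close>

lemma two_generated_square_le:
  assumes fin: "finite (carrier G)" and nc: "\<not> comm_group G"
    and p: "Factorial_Ring.prime p" "p dvd order G"
  obtains x y where "x \<in> carrier G" "y \<in> carrier G" "p\<^sup>2 \<le> card (generate G {x, y})"
proof -
  \<comment> \<open>Sylow's theorem is applied with exponent 1, so P has order exactly
    \<open>p\<close> even when \<open>m\<close> is still divisible by \<open>p\<close>.\<close>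
  obtain m where "order G = p ^ 1 * m" using p(2) by (auto elim: dvdE)
  then obtain P where P: "subgroup P G" "card P = p"
    using sylow_thm[OF p(1) is_group _ fin] by (metis power_one_right)
  have PG: "P \<subseteq> carrier G" using P subgroup.subset by auto
  have p1: "p > 1" using p prime_gt_1_nat by blast
  have triv: "D = {\<one>} \<or> D = P" if D: "subgroup D G" "D \<subseteq> P" for D
  proof -
    have finD: "finite D" "finite P" using D PG fin finite_subset by metis+
    have "card D = 1 \<or> card D = p"
      using card_subgroup_dvd[OF D(1) P(1) D(2)] P(2) p(1) by (metis prime_nat_iff)
    then show ?thesis
    proof
      assume "card D = 1"
      then show ?thesis using subgroup.one_closed[OF D(1)] by (auto simp: card_1_singleton_iff)
    next
      assume "card D = p"
      then show ?thesis using card_subset_eq[OF finD(2) D(2)] P by simp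
    qed
  qed
  have gen: "generate G {h} = P" if h: "h \<in> P" "h \<noteq> \<one>" for h
  proof -
    have "subgroup (generate G {h}) G" using h PG by (intro generate_is_subgroup) auto
    moreover have "generate G {h} \<subseteq> P" using generate_subgroup_incl[of "{h}" P] h P by auto
    moreover have "h \<in> generate G {h}" by (rule generate.incl) simp
    ultimately show ?thesis using triv h by blast
  qed
  have "P \<noteq> {\<one>}" using P p1 by auto
  then obtain h0 where h0: "h0 \<in> P" "h0 \<noteq> \<one>" using subgroup.one_closed[OF P(1)] by blast
  have "P \<noteq> carrier G" using gen[OF h0] comm_group_if_generated_by_one[OF fin] h0 PG nc by auto
  then have "\<not> P \<lhd> G" using no_real_normal_subgroup \<open>P \<noteq> {\<one>}\<close> by auto
  then obtain g h where g: "g \<in> carrier G" and h: "h \<in> P" "g \<otimes> h \<otimes> inv g \<notin> P"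
    using P normal_inv_iff by auto
  have hc: "h \<in> carrier G" using h PG by auto
  have h1: "h \<noteq> \<one>" using h g subgroup.one_closed[OF P(1)] by auto
  define D where "D = {z \<in> P. g \<otimes> z \<otimes> inv g \<in> P}"
  have conj_mult: "g \<otimes> (a \<otimes> b) \<otimes> inv g = (g \<otimes> a \<otimes> inv g) \<otimes> (g \<otimes> b \<otimes> inv g)"
    if "a \<in> carrier G" "b \<in> carrier G" for a b
  proof -
    have "inv g \<otimes> (g \<otimes> z) = z" if "z \<in> carrier G" for z
      using that g by (simp add: m_assoc[symmetric])
    then show ?thesis using that g by (simp add: m_assoc)
  qed
  have conj_inv: "g \<otimes> inv a \<otimes> inv g = inv (g \<otimes> a \<otimes> inv g)" if "a \<in> carrier G" for a
    using that g by (simp add: inv_mult_group m_assoc)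
  have "subgroup D G"
  proof (rule subgroupI)
    show "D \<subseteq> carrier G" using PG unfolding D_def by auto
    show "D \<noteq> {}" using subgroup.one_closed[OF P(1)] g unfolding D_def by auto
    show "inv a \<in> D" if "a \<in> D" for a
      using that PG P conj_inv subgroup.m_inv_closed[OF P(1)] unfolding D_def by auto
    show "a \<otimes> b \<in> D" if "a \<in> D" "b \<in> D" for a b
    proof -
      have "a \<in> carrier G" "b \<in> carrier G" using that PG unfolding D_def by auto
      then show ?thesis
        using that subgroup.m_closed[OF P(1)] unfolding D_def by (simp add: conj_mult)
    qed
  qed
  then have D1: "D = {\<one>}" using triv[of D] h unfolding D_def by auto
  define L where "L = generate G {h, g}"
  have Ls: "subgroup L G" unfolding L_def using hc g by (intro generate_is_subgroup) auto
  have PL: "P \<subseteq> L" using gen[OF h(1) h1] mono_generate[of "{h}" "{h, g}"] unfolding L_def by auto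
  have gL: "g \<in> L" unfolding L_def by (rule generate.incl) simp
  have inj: "inj_on (\<lambda>(a, b). a \<otimes> (g \<otimes> b \<otimes> inv g)) (P \<times> P)"
  proof (rule inj_onI, clarify)
    fix a b a' b' assume ab: "a \<in> P" "b \<in> P" "a' \<in> P" "b' \<in> P"
      and e: "a \<otimes> (g \<otimes> b \<otimes> inv g) = a' \<otimes> (g \<otimes> b' \<otimes> inv g)"
    have c: "a \<in> carrier G" "b \<in> carrier G" "a' \<in> carrier G" "b' \<in> carrier G" using ab PG by auto
    have cc: "g \<otimes> b \<otimes> inv g \<in> carrier G" "g \<otimes> b' \<otimes> inv g \<in> carrier G" using c g by auto
    have "g \<otimes> (b' \<otimes> inv b) \<otimes> inv g = (g \<otimes> b' \<otimes> inv g) \<otimes> inv (g \<otimes> b \<otimes> inv g)"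
      using conj_mult[of b' "inv b"] conj_inv[of b] c by simp
    also have "\<dots> = inv a' \<otimes> a"
      using e c cc by (metis inv_closed inv_solve_left inv_solve_right m_assoc m_closed)
    finally have "g \<otimes> (b' \<otimes> inv b) \<otimes> inv g \<in> P"
      using ab P by (auto intro: subgroup.m_closed subgroup.m_inv_closed)
    then have "b' \<otimes> inv b \<in> D"
      using ab P unfolding D_def by (auto intro: subgroup.m_closed subgroup.m_inv_closed)
    then have "b' \<otimes> inv b = \<one>" using D1 by simp
    then have b: "b' = b" using c by (metis inv_closed inv_equality inv_inv)
    then have "a = a'" using e c cc by (metis r_cancel)
    then show "a = a' \<and> b = b'" using b by simp
  qed
  have img: "(\<lambda>(a, b). a \<otimes> (g \<otimes> b \<otimes> inv g)) ` (P \<times> P) \<subseteq> L"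
  proof (rule image_subsetI, clarify)
    fix a b assume "a \<in> P" "b \<in> P"
    then have "a \<in> L" "b \<in> L" using PL by auto
    then show "a \<otimes> (g \<otimes> b \<otimes> inv g) \<in> L"
      using Ls gL by (intro subgroup.m_closed subgroup.m_inv_closed)
  qed
  have "finite L" using Ls fin subgroup.subset finite_subset by metis
  then have "card (P \<times> P) \<le> card L" using card_inj_on_le[OF inj img] by simp
  then have "p\<^sup>2 \<le> card L" using P by (simp add: card_cartesian_product power2_eq_square)
  then show thesis using that[of h g] hc g unfolding L_def by simp
qed

end

section \<open>Automorphisms of prime order\<close>

text \<open>For a nonidentity automorphism a prime period is the same as prime order.\<close>

definition prime_auts :: "('a, 'b) monoid_scheme \<Rightarrow> ('a \<Rightarrow> 'a) set" where
  "prime_auts G = {f \<in> auto G. f \<noteq> (\<lambda>x\<in>carrier G. x)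
     \<and> (\<exists>p. Factorial_Ring.prime p \<and> (\<forall>x\<in>carrier G. (f ^^ p) x = x))}"

definition fixed_pts :: "('a, 'b) monoid_scheme \<Rightarrow> ('a \<Rightarrow> 'a) \<Rightarrow> 'a set" where
  "fixed_pts G f = {x \<in> carrier G. f x = x}"

definition bad_sets :: "('a, 'b) monoid_scheme \<Rightarrow> nat \<Rightarrow> 'a set set" where
  "bad_sets G k = {R \<in> S_k G k. Aut_stab G R \<noteq> {(\<lambda>x\<in>carrier G. x)}}"

lemma S_k_eq: "S_k G k = ksubs (carrier G - {\<one>\<^bsub>G\<^esub>}) k"
  unfolding S_k_def ksubs_def ..

context group
begin

lemma auto_image: "f \<in> auto G \<Longrightarrow> f ` carrier G = carrier G"
  unfolding auto_def Bij_def by (auto simp: bij_betw_def)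

lemma auto_one: "f \<in> auto G \<Longrightarrow> f \<one> = \<one>"
  unfolding auto_def using hom_one[OF _ is_group is_group] by blast

lemma auto_image_nonid:
  assumes "f \<in> auto G"
  shows "f ` (carrier G - {\<one>}) = carrier G - {\<one>}"
proof -
  have "inj_on f (carrier G)" using assms unfolding auto_def Bij_def bij_betw_def by auto
  then have "f ` (carrier G - {\<one>}) = f ` carrier G - f ` {\<one>}"
    by (intro inj_on_image_set_diff[of f "carrier G"]) auto
  then show ?thesis using auto_image[OF assms] auto_one[OF assms] by simp
qed

lemma fixed_pts_subgroup:
  assumes "f \<in> auto G"
  shows "subgroup (fixed_pts G f) G"
proof -
  have f: "f \<in> hom G G" using assms unfolding auto_def by simp
  interpret f: group_hom G G f by (intro group_hom.intro group_hom_axioms.intro f is_group)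
  show ?thesis
  proof (rule subgroupI)
    show "fixed_pts G f \<noteq> {}" using f.hom_one one_closed unfolding fixed_pts_def by blast
  qed (auto simp: fixed_pts_def)
qed

lemma fixed_pts_proper:
  assumes "f \<in> prime_auts G"
  shows "fixed_pts G f \<noteq> carrier G"
proof
  assume e: "fixed_pts G f = carrier G"
  have "f \<in> extensional (carrier G)" using assms unfolding prime_auts_def auto_def Bij_def by simp
  then have "f = (\<lambda>x\<in>carrier G. x)"
    using e by (intro extensionalityI[of _ "carrier G"]) (auto simp: fixed_pts_def)
  then show False using assms unfolding prime_auts_def by simp
qed

lemma prime_auts_period_map:
  assumes "finite (carrier G)" "f \<in> prime_auts G"
  shows "\<exists>p. prime_period_map (carrier G - {\<one>}) f p (fixed_pts G f - {\<one>})"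
proof -
  obtain p where p: "Factorial_Ring.prime p" "\<forall>x\<in>carrier G. (f ^^ p) x = x"
    using assms(2) unfolding prime_auts_def by blast
  have "f \<in> auto G" using assms(2) unfolding prime_auts_def by simp
  then have "prime_period_map (carrier G - {\<one>}) f p (fixed_pts G f - {\<one>})"
    using assms(1) p auto_image_nonid by unfold_locales (auto simp: fixed_pts_def)
  then show ?thesis ..
qed

text \<open>If f is a nontrivial stabilising automorphism of order e and q is a prime divisor of e,
  then the power of f with exponent e / q has order q and still stabilises \<open>R\<close>.\<close>

lemma prime_aut_of_stabilizer:
  assumes fin: "finite (carrier G)" and R: "R \<subseteq> carrier G"
    and ne: "Aut_stab G R \<noteq> {(\<lambda>x\<in>carrier G. x)}"
  shows "\<exists>f\<in>prime_auts G. f ` R = R"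
proof -
  interpret A: group "AutoGroup G" by (rule AutoGroup)
  have carA: "carrier (AutoGroup G) = auto G" unfolding AutoGroup_def by simp
  have oneA: "\<one>\<^bsub>AutoGroup G\<^esub> = (\<lambda>x\<in>carrier G. x)" unfolding AutoGroup_def BijGroup_def by simp
  have multA: "f \<otimes>\<^bsub>AutoGroup G\<^esub> g = compose (carrier G) f g" if "f \<in> auto G" "g \<in> auto G" for f g
    using that unfolding AutoGroup_def BijGroup_def auto_def by simp
  have "(\<lambda>x\<in>carrier G. x) \<in> Aut_stab G R"
    unfolding Aut_stab_def using id_in_auto R by (auto simp: image_iff)
  then obtain f where f: "f \<in> Aut_stab G R" "f \<noteq> (\<lambda>x\<in>carrier G. x)" using ne by blast
  have fa: "f \<in> auto G" and fR: "f ` R = R" using f unfolding Aut_stab_def by auto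
  have finA: "finite (carrier (AutoGroup G))" using carA finite_auto[OF fin] by simp
  \<comment> \<open>Composition in \<open>AutoGroup\<close> is restricted to the carrier, so group
    powers agree with iterates only at points of the carrier.\<close>
  have pow_app: "(h [^]\<^bsub>AutoGroup G\<^esub> (i::nat)) x = (h ^^ i) x" if h: "h \<in> auto G" and x: "x \<in> carrier G" for h i x
    using x
  proof (induction i arbitrary: x)
    case 0
    then show ?case by (simp add: oneA)
  next
    case (Suc i)
    have hx: "h x \<in> carrier G" using auto_image[OF h] Suc.prems by blast
    have "h [^]\<^bsub>AutoGroup G\<^esub> i \<in> auto G" using A.nat_pow_closed h carA by metis
    then have "(h [^]\<^bsub>AutoGroup G\<^esub> Suc i) x = (h [^]\<^bsub>AutoGroup G\<^esub> i) (h x)"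
      using h Suc.prems by (simp add: multA compose_def)
    then show ?case using Suc.IH[OF hx] by (simp add: funpow_swap1)
  qed
  define e where "e = A.ord f"
  have fc: "f \<in> carrier (AutoGroup G)" using fa carA by simp
  have o1: "e \<noteq> 1" using f(2) A.ord_eq_1[OF fc] oneA unfolding e_def by simp
  have o0: "e \<ge> 1" using A.ord_ge_1[OF finA fc] unfolding e_def .
  obtain q where q: "Factorial_Ring.prime q" "q dvd e" using prime_factor_nat[OF o1] by blast
  define j where "j = e div q"
  have jq: "j * q = e" using q unfolding j_def by simp
  define \<sigma> where "\<sigma> = f [^]\<^bsub>AutoGroup G\<^esub> j"
  have sa: "\<sigma> \<in> auto G" using A.nat_pow_closed[OF fc] carA unfolding \<sigma>_def by simp
  have "j > 0" using jq o0 by (cases j) auto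
  moreover from this have "j * 1 < j * q" using prime_gt_1_nat[OF q(1)] by (intro mult_strict_left_mono)
  ultimately have "j < e" "j > 0" using jq by simp_all
  then have "\<not> e dvd j" using dvd_imp_le by fastforce
  then have s1: "\<sigma> \<noteq> (\<lambda>x\<in>carrier G. x)" using A.pow_eq_id[OF fc, of j] oneA unfolding \<sigma>_def e_def by simp
  have "\<sigma> [^]\<^bsub>AutoGroup G\<^esub> q = \<one>\<^bsub>AutoGroup G\<^esub>"
    unfolding \<sigma>_def A.nat_pow_pow[OF fc] jq e_def using A.pow_ord_eq_1[OF fc] .
  then have "(\<sigma> ^^ q) x = x" if "x \<in> carrier G" for x
    using pow_app[OF sa that, of q] oneA that by simp
  then have "\<sigma> \<in> prime_auts G" using sa s1 q unfolding prime_auts_def by auto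
  moreover have "\<sigma> ` R = R"
  proof -
    have "(f ^^ i) ` R = R" for i
    proof (induction i)
      case (Suc i)
      have "(f ^^ Suc i) ` R = f ` (f ^^ i) ` R" by (simp add: image_image)
      then show ?case using Suc fR by (simp only:)
    qed simp
    moreover have "\<sigma> ` R = (f ^^ j) ` R" using pow_app[OF fa] R unfolding \<sigma>_def by (intro image_cong) auto
    ultimately show ?thesis by simp
  qed
  ultimately show ?thesis by blast
qed

lemma finite_prime_auts: "finite (carrier G) \<Longrightarrow> finite (prime_auts G)"
  using finite_auto unfolding prime_auts_def by (auto intro: finite_subset)

lemma card_bad_sets_le:
  assumes fin: "finite (carrier G)"
  shows "card (bad_sets G k) \<le> (\<Sum>f\<in>prime_auts G. card {R \<in> ksubs (carrier G - {\<one>}) k. f ` R = R})"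
proof -
  have "bad_sets G k \<subseteq> (\<Union>f\<in>prime_auts G. {R \<in> ksubs (carrier G - {\<one>}) k. f ` R = R})"
  proof
    fix R assume R: "R \<in> bad_sets G k"
    then have "R \<in> ksubs (carrier G - {\<one>}) k" unfolding bad_sets_def S_k_eq by simp
    moreover from this have "\<exists>f\<in>prime_auts G. f ` R = R"
      using prime_aut_of_stabilizer[OF fin, of R] R unfolding bad_sets_def ksubs_def by blast
    ultimately show "R \<in> (\<Union>f\<in>prime_auts G. {R \<in> ksubs (carrier G - {\<one>}) k. f ` R = R})" by blast
  qed
  then have "card (bad_sets G k) \<le> card (\<Union>f\<in>prime_auts G. {R \<in> ksubs (carrier G - {\<one>}) k. f ` R = R})"
    using fin finite_prime_auts[OF fin] by (intro card_mono finite_UN_I) (auto simp: finite_ksubs)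
  also have "\<dots> \<le> (\<Sum>f\<in>prime_auts G. card {R \<in> ksubs (carrier G - {\<one>}) k. f ` R = R})"
    by (rule card_UN_le[OF finite_prime_auts[OF fin]])
  finally show ?thesis .
qed

lemma card_nonid: "finite (carrier G) \<Longrightarrow> card (carrier G - {\<one>}) = order G - 1"
  unfolding order_def by simp

lemma card_fixed_nonid:
  assumes "finite (carrier G)" "f \<in> auto G"
  shows "card (fixed_pts G f - {\<one>}) = card (fixed_pts G f) - 1" "card (fixed_pts G f) \<ge> 1"
proof -
  have "\<one> \<in> fixed_pts G f" using subgroup.one_closed[OF fixed_pts_subgroup[OF assms(2)]] .
  moreover have "finite (fixed_pts G f)" using assms(1) unfolding fixed_pts_def by simp
  ultimately show "card (fixed_pts G f - {\<one>}) = card (fixed_pts G f) - 1" "card (fixed_pts G f) \<ge> 1"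
    by (auto simp: Suc_le_eq card_gt_0_iff)
qed

text \<open>Cauchy--Schwarz over the possible intersections of \<open>R\<close> with the fixed points; efficient only
  for small groups.\<close>

lemma bad_sets_bound_by_generators:
  assumes fin: "finite (carrier G)"
    and idx: "\<And>H. subgroup H G \<Longrightarrow> H \<noteq> carrier G \<Longrightarrow> m * card H \<le> order G" and m: "m > 0"
    and Y: "Y \<subseteq> carrier G" "card Y \<le> d" "generate G Y = carrier G"
    and num: "order G ^ (2 * d + 2) * 2 ^ (order G div m - 1) < ((order G - 1) choose k)"
  shows "card (bad_sets G k) * order G < ((order G - 1) choose k)"
proof -
  let ?U = "carrier G - {\<one>}"
  let ?n = "order G"
  let ?B = "(?n - 1) choose k"
  have n1: "?n \<ge> 1" using fin unfolding order_def by (metis One_nat_def Suc_leI card_gt_0_iff empty_iff one_closed)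
  define M where "M = real (2 ^ (?n div m - 1) * ?B)"
  have each: "real (card {R \<in> ksubs ?U k. f ` R = R}) \<le> sqrt M" if f: "f \<in> prime_auts G" for f
  proof -
    obtain p where "prime_period_map ?U f p (fixed_pts G f - {\<one>})"
      using prime_auts_period_map[OF fin f] by blast
    then interpret prime_period_map ?U f p "fixed_pts G f - {\<one>}" .
    have fa: "f \<in> auto G" using f unfolding prime_auts_def by simp
    have "m * card (fixed_pts G f) \<le> ?n" using idx[OF fixed_pts_subgroup[OF fa] fixed_pts_proper[OF f]] .
    then have "card (fixed_pts G f) \<le> ?n div m" using m by (simp add: less_eq_div_iff_mult_less_eq mult.commute)
    then have "card (fixed_pts G f - {\<one>}) \<le> ?n div m - 1" using card_fixed_nonid(1)[OF fin fa] by simp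
    then have "(2::nat) ^ card (fixed_pts G f - {\<one>}) * ?B \<le> 2 ^ (?n div m - 1) * ?B"
      by (intro mult_right_mono power_increasing) auto
    then have "(card (inv_sets k))\<^sup>2 \<le> 2 ^ (?n div m - 1) * ?B"
      using card_inv_sets_square_le[of k] unfolding card_nonid[OF fin] by (rule order_trans[rotated])
    then have "(real (card (inv_sets k)))\<^sup>2 \<le> M" unfolding M_def by (metis of_nat_le_iff of_nat_power)
    then show ?thesis unfolding inv_sets_def by (intro real_le_rsqrt)
  qed
  have cardP: "card (prime_auts G) \<le> ?n ^ d"
  proof -
    have "prime_auts G \<subseteq> {f \<in> auto G. \<forall>x\<in>{}. f x = x}" unfolding prime_auts_def by auto
    then have "card (prime_auts G) \<le> card {f \<in> auto G. \<forall>x\<in>{}. f x = x}"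
      using finite_auto[OF fin] by (intro card_mono) auto
    also have "\<dots> \<le> ?n ^ card Y" using card_auto_fixing_le[OF fin, of "{}" Y] Y by simp
    also have "\<dots> \<le> ?n ^ d" using n1 Y by (intro power_increasing) auto
    finally show ?thesis .
  qed
  have "real (card (bad_sets G k)) \<le> (\<Sum>f\<in>prime_auts G. real (card {R \<in> ksubs ?U k. f ` R = R}))"
    using of_nat_mono[OF card_bad_sets_le[OF fin, of k], where 'a = real] by simp
  also have "\<dots> \<le> (\<Sum>f\<in>prime_auts G. sqrt M)" using each by (rule sum_mono)
  also have "\<dots> = card (prime_auts G) * sqrt M" by simp
  also have "\<dots> \<le> real (?n ^ d) * sqrt M"
    using cardP unfolding M_def by (intro mult_right_mono) (auto simp only: of_nat_le_iff real_sqrt_ge_zero of_nat_0_le_iff)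
  finally have b: "real (card (bad_sets G k)) \<le> real (?n ^ d) * sqrt M" .
  have "real (card (bad_sets G k)) * ?n \<le> real (?n ^ (d + 1)) * sqrt M"
    using mult_right_mono[OF b, of "real ?n"] by (simp add: mult_ac)
  \<comment> \<open>Squaring removes the root. The exponent \<open>2 * d + 2\<close> comes from
    \<open>?n ^ d\<close> automorphisms and the extra factor \<open>?n\<close>; one factor
    \<open>?B\<close> is already inside \<open>M\<close>, and \<open>num\<close> supplies the
    other.\<close>
  then have "(real (card (bad_sets G k)) * ?n)\<^sup>2 \<le> (real (?n ^ (d + 1)) * sqrt M)\<^sup>2"
    by (intro power_mono) auto
  also have "\<dots> = real (?n ^ (2 * d + 2)) * M"
    unfolding M_def by (simp add: power_mult_distrib power_mult[symmetric] power_add[symmetric] power2_eq_square algebra_simps mult_2_right[symmetric])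
  also have "\<dots> = real (?n ^ (2 * d + 2) * 2 ^ (?n div m - 1)) * ?B" unfolding M_def by simp
  also have "\<dots> < real ?B * ?B"
  proof (rule mult_strict_right_mono)
    show "real (?n ^ (2 * d + 2) * 2 ^ (?n div m - 1)) < real ?B" using num by (rule of_nat_less_iff[THEN iffD2])
    then show "0 < real ?B" by (rule order_le_less_trans[rotated]) simp
  qed
  finally have "(real (card (bad_sets G k)) * ?n)\<^sup>2 < (real ?B)\<^sup>2" by (simp add: power2_eq_square)
  then have "real (card (bad_sets G k)) * ?n < real ?B" by (rule power2_less_imp_less) simp
  then show ?thesis by (metis of_nat_less_iff of_nat_mult)
qed

end

section \<open>Sampling bound\<close>

text \<open>Removing \<open>B\<close> leaves an arbitrary set of \<open>k0 - card B\<close> points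
  of \<open>U - B\<close>, in which the rest of \<open>K\<close> has density at most
  \<open>q\<close>.\<close>

lemma sum_ksubs_superset_le:
  fixes g q :: real
  assumes U: "finite U" "B \<subseteq> U" "B \<subseteq> K" and k0: "card B \<le> k0" "k0 \<le> card U" and g: "0 \<le> g"
    and q: "real (card (K \<inter> U) - card B) \<le> q * real (card U - card B)" "0 \<le> q" "q \<le> 1"
  shows "(\<Sum>S\<in>{S \<in> ksubs U k0. B \<subseteq> S}. g ^ card (S - K))
    \<le> ((card U - card B) choose (k0 - card B)) * (q + g) ^ (k0 - card B)"
proof -
  have finB: "finite B" using U finite_subset by blast
  have "(\<Sum>S\<in>{S \<in> ksubs U k0. B \<subseteq> S}. g ^ card (S - K))
      = (\<Sum>V\<in>ksubs (U - B) (k0 - card B). g ^ card (V - (K \<inter> U - B)))"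
  proof (rule sum.reindex_bij_witness[where j = "\<lambda>S. S - B" and i = "\<lambda>V. V \<union> B"])
    fix S assume S: "S \<in> {S \<in> ksubs U k0. B \<subseteq> S}"
    show "S - B \<union> B = S" using S by auto
    show "S - B \<in> ksubs (U - B) (k0 - card B)"
      using S finB unfolding ksubs_def by (auto simp: card_Diff_subset)
    have "S - B - (K \<inter> U - B) = S - K" using S U unfolding ksubs_def by auto
    then show "g ^ card (S - B - (K \<inter> U - B)) = g ^ card (S - K)" by simp
  next
    fix V assume V: "V \<in> ksubs (U - B) (k0 - card B)"
    then have f: "finite V" using U unfolding ksubs_def by (auto intro: finite_subset)
    show "V \<union> B - B = V" using V unfolding ksubs_def by auto
    have "card (V \<union> B) = card V + card B"
      using V f finB unfolding ksubs_def by (intro card_Un_disjoint) auto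
    then show "V \<union> B \<in> {S \<in> ksubs U k0. B \<subseteq> S}" using V U k0 unfolding ksubs_def by auto
  qed
  also have "\<dots> \<le> (card (U - B) choose (k0 - card B)) * (q + g) ^ (k0 - card B)"
  proof (rule sum_ksubs_power_le)
    have cU: "card (U - B) = card U - card B" using finB U by (simp add: card_Diff_subset)
    show "k0 - card B \<le> card (U - B)" using k0 cU by simp
    have "card (K \<inter> U - B) = card (K \<inter> U) - card B" using finB U by (intro card_Diff_subset) auto
    then show "real (card (K \<inter> U - B)) \<le> q * real (card (U - B))" using q cU by simp
  qed (use U g q in auto)
  finally show ?thesis using finB U by (simp add: card_Diff_subset)
qed

section \<open>Summing over automorphisms, grouped by the subgroup their sampled fixed points
  generate\<close>

context group
begin

text \<open>The least number of further generators for which \<open>extend_to_generating_set\<close>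
  guarantees the whole group.\<close>

definition ext_rank :: "nat \<Rightarrow> 'a set \<Rightarrow> nat" where
  "ext_rank m B = (LEAST s. order G < m * 2 ^ s * card (generate G B))"

text \<open>The sets that the greedy choice can return inside the proper subgroup of fixed points of
  an automorphism.\<close>

definition indep_sets :: "'a set set" where
  "indep_sets = {B. B \<subseteq> carrier G - {\<one>} \<and> generate G B \<noteq> carrier G \<and> 2 ^ card B \<le> card (generate G B)}"

text \<open>Covers all pairs of \<open>card B\<close> and \<open>ext_rank m B\<close> with
  \<open>B\<close> in \<open>indep_sets\<close>: minimality of the rank bounds
  \<open>m * 2 ^ (s - 1)\<close> times the order of the generated subgroup, which is at least
  \<open>2 ^ r\<close>.\<close>

definition rank_pairs :: "nat \<Rightarrow> (nat \<times> nat) set" where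
  "rank_pairs m = {(r, s). 1 \<le> s \<and> m * 2 ^ (s - 1) * 2 ^ r \<le> order G}"

lemma finite_rank_pairs: "m > 0 \<Longrightarrow> finite (rank_pairs m)"
proof -
  assume m: "m > 0"
  have "rank_pairs m \<subseteq> {..order G} \<times> {..order G}"
  proof
    fix x assume "x \<in> rank_pairs m"
    then obtain r s where x: "x = (r, s)" "1 \<le> s" "m * 2 ^ (s - 1) * 2 ^ r \<le> order G"
      unfolding rank_pairs_def by auto
    have "2 ^ (s - 1 + r) \<le> m * 2 ^ (s - 1) * 2 ^ r" using m by (simp add: power_add)
    then have "2 ^ (s - 1 + r) \<le> order G" using x by linarith
    moreover have "s - 1 + r < 2 ^ (s - 1 + r)" by (rule less_exp)
    ultimately have "s - 1 + r < order G" by linarith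
    then show "x \<in> {..order G} \<times> {..order G}" using x by auto
  qed
  then show ?thesis by (rule finite_subset) simp
qed

context
  fixes m :: nat
  assumes fin: "finite (carrier G)" and m: "m > 0"
    and idx: "\<And>H. subgroup H G \<Longrightarrow> H \<noteq> carrier G \<Longrightarrow> m * card H \<le> order G"
begin

lemma ext_rank_props:
  assumes B: "B \<in> indep_sets"
  shows "order G < m * 2 ^ ext_rank m B * card (generate G B)"
    and "1 \<le> ext_rank m B"
    and "m * 2 ^ (ext_rank m B - 1) * card (generate G B) \<le> order G"
proof -
  let ?K = "generate G B"
  have K: "subgroup ?K G" "?K \<noteq> carrier G" using B unfolding indep_sets_def by (auto intro!: generate_is_subgroup)
  have c: "card ?K \<ge> 1"
    using subgroup.one_closed[OF K(1)] subgroup.subset[OF K(1)] fin finite_subset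
    by (metis One_nat_def Suc_leI card_gt_0_iff empty_iff)
  \<comment> \<open>The exponent \<open>order G\<close> always qualifies, so the minimum in
    \<open>ext_rank\<close> is attained.\<close>
  have "order G < m * 2 ^ order G * card ?K"
  proof -
    have "order G < 2 ^ order G" by (rule less_exp)
    also have "\<dots> \<le> m * 2 ^ order G * card ?K" using m c by simp
    finally show ?thesis .
  qed
  then show 1: "order G < m * 2 ^ ext_rank m B * card ?K" unfolding ext_rank_def by (rule LeastI)
  show 2: "1 \<le> ext_rank m B"
  proof (rule ccontr)
    assume "\<not> 1 \<le> ext_rank m B"
    then have "ext_rank m B = 0" by simp
    then show False using 1 idx[OF K] by simp
  qed
  then have "\<not> order G < m * 2 ^ (ext_rank m B - 1) * card ?K"
    unfolding ext_rank_def by (intro not_less_Least) (simp add: ext_rank_def)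
  then show "m * 2 ^ (ext_rank m B - 1) * card ?K \<le> order G" by simp
qed

lemma card_prime_auts_fixing_le:
  assumes B: "B \<in> indep_sets"
  shows "card {f \<in> prime_auts G. B \<subseteq> fixed_pts G f} \<le> order G ^ ext_rank m B"
proof -
  let ?K = "generate G B"
  have Bc: "B \<subseteq> carrier G" using B unfolding indep_sets_def by auto
  obtain Y where Y: "Y \<subseteq> carrier G" "card Y \<le> ext_rank m B" "generate G (?K \<union> Y) = carrier G"
    using extend_to_generating_set[OF fin idx generate_is_subgroup[OF Bc] ext_rank_props(1)[OF B]] by blast
  have "{f \<in> prime_auts G. B \<subseteq> fixed_pts G f} \<subseteq> {f \<in> auto G. \<forall>x\<in>?K. f x = x}"
  proof
    fix f assume f: "f \<in> {f \<in> prime_auts G. B \<subseteq> fixed_pts G f}"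
    then have fa: "f \<in> auto G" unfolding prime_auts_def by simp
    have "?K \<subseteq> fixed_pts G f" using f generate_subgroup_incl[OF _ fixed_pts_subgroup[OF fa], of B] by simp
    then show "f \<in> {f \<in> auto G. \<forall>x\<in>?K. f x = x}" using fa unfolding fixed_pts_def by auto
  qed
  then have "card {f \<in> prime_auts G. B \<subseteq> fixed_pts G f} \<le> card {f \<in> auto G. \<forall>x\<in>?K. f x = x}"
    using finite_auto[OF fin] by (intro card_mono) auto
  also have "\<dots> \<le> order G ^ card Y" using card_auto_fixing_le[OF fin generate_incl[OF Bc] Y(1,3)] .
  also have "\<dots> \<le> order G ^ ext_rank m B"
  proof (rule power_increasing[OF Y(2)])
    show "1 \<le> order G" using fin unfolding order_def by (metis One_nat_def Suc_leI card_gt_0_iff empty_iff one_closed)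
  qed
  finally show ?thesis .
qed

text \<open>Each pair of an automorphism f and a sample S is charged to a set B of r elements that
  generates the same subgroup as all sampled fixed points. With s the extension rank of B, at most
  \<open>order G ^ s\<close> automorphisms fix B, while each of the \<open>k0 - r\<close> other
  sampled points either falls into the generated subgroup, of density at most
  \<open>1 / (m * 2 ^ (s - 1))\<close>, or costs \<open>g\<close>. Choosing B in the group and then
  S around it is the same as choosing S and then B inside S, whence
  \<open>k0 choose r\<close>.\<close>

lemma sum_over_prime_auts_le:
  fixes g :: real
  assumes g: "0 \<le> g" and k0: "k0 \<le> order G - 1"
  shows "(\<Sum>f\<in>prime_auts G. \<Sum>S\<in>ksubs (carrier G - {\<one>}) k0. g ^ card (S - (fixed_pts G f - {\<one>})))
    \<le> ((order G - 1) choose k0) *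
      (\<Sum>(r, s)\<in>rank_pairs m. order G ^ s * (k0 choose r) * (1 / (m * 2 ^ (s - 1)) + g) ^ (k0 - r))"
proof -
  let ?U = "carrier G - {\<one>}"
  let ?n = "order G"
  let ?u = "order G - 1"
  have finU: "finite ?U" using fin by simp
  have cU: "card ?U = ?u" using card_nonid[OF fin] .
  have finI: "finite indep_sets" unfolding indep_sets_def
    by (rule finite_subset[of _ "Pow ?U"]) (use finU in auto)
  define x where "x s = 1 / (real m * 2 ^ (s - 1)) + g" for s :: nat
  have x0: "0 \<le> x s" for s using g m unfolding x_def by simp
  define h where "h f S B = (if B \<subseteq> S \<and> B \<subseteq> fixed_pts G f then g ^ card (S - generate G B) else 0)"
    for f :: "'a \<Rightarrow> 'a" and S B
  have h0: "0 \<le> h f S B" for f S B using g unfolding h_def by simp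
  have "(\<Sum>f\<in>prime_auts G. \<Sum>S\<in>ksubs ?U k0. g ^ card (S - (fixed_pts G f - {\<one>})))
      \<le> (\<Sum>f\<in>prime_auts G. \<Sum>S\<in>ksubs ?U k0. \<Sum>B\<in>indep_sets. h f S B)"
  proof (intro sum_mono)
    fix f S assume f: "f \<in> prime_auts G" and S: "S \<in> ksubs ?U k0"
    have fa: "f \<in> auto G" using f unfolding prime_auts_def by simp
    have SU: "S \<subseteq> ?U" using S unfolding ksubs_def by simp
    let ?F = "S \<inter> fixed_pts G f"
    obtain B where B: "B \<subseteq> ?F" "?F \<subseteq> generate G B" "2 ^ card B \<le> card (generate G B)"
      using generating_subset_exists[OF fin, of ?F] SU by blast
    have K: "generate G B \<subseteq> fixed_pts G f"
      using generate_subgroup_incl[OF _ fixed_pts_subgroup[OF fa], of B] B by auto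
    have "generate G B \<noteq> carrier G"
      using K fixed_pts_proper[OF f] unfolding fixed_pts_def by auto
    then have BI: "B \<in> indep_sets" using B SU unfolding indep_sets_def by auto
    \<comment> \<open>All sampled fixed points lie in the subgroup generated by \<open>B\<close>,
      and that subgroup is fixed pointwise; so the weight depends on \<open>f\<close> only through
      \<open>B\<close>.\<close>
    have "S - (fixed_pts G f - {\<one>}) = S - generate G B" using SU K B by auto
    then have "g ^ card (S - (fixed_pts G f - {\<one>})) = h f S B" using B unfolding h_def by auto
    also have "\<dots> \<le> (\<Sum>B\<in>indep_sets. h f S B)" using finI h0 BI by (intro member_le_sum) auto
    finally show "g ^ card (S - (fixed_pts G f - {\<one>})) \<le> (\<Sum>B\<in>indep_sets. h f S B)" .
  qed
  also have "\<dots> = (\<Sum>f\<in>prime_auts G. \<Sum>B\<in>indep_sets. \<Sum>S\<in>ksubs ?U k0. h f S B)"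
    by (intro sum.cong[OF refl] sum.swap)
  also have "\<dots> = (\<Sum>B\<in>indep_sets. \<Sum>f\<in>prime_auts G. \<Sum>S\<in>ksubs ?U k0. h f S B)"
    by (rule sum.swap)
  also have "\<dots> \<le> (\<Sum>B\<in>indep_sets. real (?n ^ ext_rank m B) *
      (if card B \<le> k0 then ((?u - card B) choose (k0 - card B)) * x (ext_rank m B) ^ (k0 - card B) else 0))"
  proof (rule sum_mono)
    fix B assume B: "B \<in> indep_sets"
    let ?K = "generate G B" and ?s = "ext_rank m B"
    let ?\<Phi> = "\<Sum>S\<in>{S \<in> ksubs ?U k0. B \<subseteq> S}. g ^ card (S - ?K)"
    have BU: "B \<subseteq> ?U" using B unfolding indep_sets_def by simp
    have finB: "finite B" using BU finU finite_subset by blast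
    have BK: "B \<subseteq> ?K" by (auto intro: generate.incl)
    have "(\<Sum>f\<in>prime_auts G. \<Sum>S\<in>ksubs ?U k0. h f S B)
        = (\<Sum>f\<in>prime_auts G. if B \<subseteq> fixed_pts G f then ?\<Phi> else 0)"
    proof (rule sum.cong[OF refl])
      fix f
      show "(\<Sum>S\<in>ksubs ?U k0. h f S B) = (if B \<subseteq> fixed_pts G f then ?\<Phi> else 0)"
        using sum.inter_filter[OF finite_ksubs[OF finU, of k0], where g = "\<lambda>S. g ^ card (S - ?K)" and P = "\<lambda>S. B \<subseteq> S"]
        unfolding h_def by simp
    qed
    also have "\<dots> = (\<Sum>f\<in>{f \<in> prime_auts G. B \<subseteq> fixed_pts G f}. ?\<Phi>)"
      by (rule sum.inter_filter[OF finite_prime_auts[OF fin], symmetric])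
    also have "\<dots> = real (card {f \<in> prime_auts G. B \<subseteq> fixed_pts G f}) * ?\<Phi>" by simp
    also have "\<dots> \<le> real (?n ^ ?s) * ?\<Phi>"
      using of_nat_mono[OF card_prime_auts_fixing_le[OF B], where 'a = real] g
      by (intro mult_right_mono sum_nonneg) auto
    also have "?\<Phi> \<le> (if card B \<le> k0 then ((?u - card B) choose (k0 - card B)) * x ?s ^ (k0 - card B) else 0)"
    proof (cases "card B \<le> k0")
      case True
      define M where "M = m * 2 ^ (?s - 1)"
      have M1: "1 \<le> M" unfolding M_def using m by simp
      have KM: "M * card ?K \<le> ?n" unfolding M_def using ext_rank_props(3)[OF B] .
      have "\<one> \<in> ?K" by (rule generate.one)
      moreover have finK: "finite ?K" using fin generate_incl[of B] BU finite_subset by blast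
      moreover have Kc: "?K \<subseteq> carrier G" using generate_incl[of B] BU by blast
      ultimately have cK: "card (?K \<inter> ?U) = card ?K - 1" "card ?K \<ge> 1"
        by (auto simp: Int_absorb2 Diff_Int_distrib Suc_le_eq card_gt_0_iff)
      have "card B \<le> card (?K \<inter> ?U)" using BK BU finK by (intro card_mono) auto
      then have b: "card B \<le> card ?K - 1" using cK by simp
      \<comment> \<open>Deleting the identity and \<open>B\<close> from both the subgroup and the
        group does not raise the density bound, because \<open>M\<close> is at least 1.\<close>
      have "M * (card ?K - 1 - card B) \<le> ?n - 1 - card B"
      proof -
        have "M * (card ?K - 1 - card B) + (1 + card B) \<le> M * (card ?K - 1 - card B) + M * (1 + card B)"
          using mult_right_mono[OF M1, of "1 + card B"] by (intro add_left_mono) simp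
        also have "\<dots> = M * ((card ?K - 1 - card B) + (1 + card B))" by (rule add_mult_distrib2[symmetric])
        also have "(card ?K - 1 - card B) + (1 + card B) = card ?K" using b cK(2) by simp
        finally show ?thesis using KM by linarith
      qed
      then have "real M * real (card ?K - 1 - card B) \<le> real (?n - 1 - card B)"
        by (metis of_nat_le_iff of_nat_mult)
      then have "real (card ?K - 1 - card B) \<le> 1 / real M * real (?n - 1 - card B)"
        using M1 by (simp add: field_simps)
      then have q: "real (card (?K \<inter> ?U) - card B) \<le> 1 / real M * real (card ?U - card B)"
        unfolding cK cU .
      have "?\<Phi> \<le> ((card ?U - card B) choose (k0 - card B)) * (1 / real M + g) ^ (k0 - card B)"
        by (rule sum_ksubs_superset_le[OF finU BU BK True _ g q]) (use k0 cU M1 in \<open>auto simp: field_simps\<close>)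
      then show ?thesis using True unfolding x_def cU M_def by simp
    next
      case False
      have "{S \<in> ksubs ?U k0. B \<subseteq> S} = {}"
      proof (rule ccontr)
        assume "{S \<in> ksubs ?U k0. B \<subseteq> S} \<noteq> {}"
        then obtain S where S: "S \<subseteq> ?U" "card S = k0" "B \<subseteq> S" unfolding ksubs_def by auto
        then have "card B \<le> k0" using card_mono[of S B] finU finite_subset by blast
        then show False using False by simp
      qed
      then have "?\<Phi> = 0" by (simp only: sum.empty)
      then show ?thesis using False by simp
    qed
    finally show "(\<Sum>f\<in>prime_auts G. \<Sum>S\<in>ksubs ?U k0. h f S B) \<le> real (?n ^ ?s) *
        (if card B \<le> k0 then ((?u - card B) choose (k0 - card B)) * x ?s ^ (k0 - card B) else 0)"
      by (simp add: mult_left_mono)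
  qed
  also have "\<dots> = (\<Sum>t\<in>rank_pairs m. \<Sum>B\<in>{B \<in> indep_sets. (card B, ext_rank m B) = t}. real (?n ^ ext_rank m B) *
      (if card B \<le> k0 then ((?u - card B) choose (k0 - card B)) * x (ext_rank m B) ^ (k0 - card B) else 0))"
  proof (rule sum.group[symmetric, OF finI finite_rank_pairs[OF m]], rule image_subsetI)
    fix B assume B: "B \<in> indep_sets"
    have "m * 2 ^ (ext_rank m B - 1) * 2 ^ card B \<le> m * 2 ^ (ext_rank m B - 1) * card (generate G B)"
      using B unfolding indep_sets_def by (intro mult_left_mono) auto
    also have "\<dots> \<le> ?n" using ext_rank_props(3)[OF B] .
    finally show "(card B, ext_rank m B) \<in> rank_pairs m"
      using ext_rank_props(2)[OF B] unfolding rank_pairs_def by simp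
  qed
  also have "\<dots> \<le> (\<Sum>t\<in>rank_pairs m. (?u choose k0) * (?n ^ snd t * (k0 choose fst t) * x (snd t) ^ (k0 - fst t)))"
  proof (rule sum_mono)
    fix t assume "t \<in> rank_pairs m"
    obtain r s where t: "t = (r, s)" by (cases t)
    let ?I = "{B \<in> indep_sets. (card B, ext_rank m B) = t}"
    let ?c = "real (?n ^ s) * (if r \<le> k0 then ((?u - r) choose (k0 - r)) * x s ^ (k0 - r) else 0)"
    have c0: "0 \<le> ?c" using x0 by simp
    have "(\<Sum>B\<in>?I. real (?n ^ ext_rank m B) *
      (if card B \<le> k0 then ((?u - card B) choose (k0 - card B)) * x (ext_rank m B) ^ (k0 - card B) else 0))
      = (\<Sum>B\<in>?I. ?c)" by (rule sum.cong[OF refl]) (simp add: t)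
    also have "\<dots> = card ?I * ?c" by simp
    also have "\<dots> \<le> (?u choose r) * ?c"
    proof (rule mult_right_mono[OF _ c0])
      have "?I \<subseteq> ksubs ?U r" unfolding t indep_sets_def ksubs_def by auto
      then have "card ?I \<le> ?u choose r"
        using card_mono[OF finite_ksubs[OF finU]] card_ksubs[OF finU, of r] cU by metis
      then show "real (card ?I) \<le> real (?u choose r)" by simp
    qed
    also have "\<dots> \<le> (?u choose k0) * (?n ^ s * (k0 choose r) * x s ^ (k0 - r))"
    proof (cases "r \<le> k0")
      case True
      have e: "real (?u choose r) * real ((?u - r) choose (k0 - r)) = real (?u choose k0) * real (k0 choose r)"
        using choose_mult[OF True k0] by (metis of_nat_mult)
      have "real (?u choose r) * ?c
        = (real (?u choose r) * real ((?u - r) choose (k0 - r))) * (real (?n ^ s) * x s ^ (k0 - r))"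
        using True by (simp only: if_True mult_ac)
      also have "\<dots> = (?u choose k0) * (?n ^ s * (k0 choose r) * x s ^ (k0 - r))"
        unfolding e by (simp only: mult_ac of_nat_power of_nat_mult)
      finally show ?thesis by (rule eq_refl)
    next
      case False
      then show ?thesis using x0 by simp
    qed
    finally show "(\<Sum>B\<in>?I. real (?n ^ ext_rank m B) *
      (if card B \<le> k0 then ((?u - card B) choose (k0 - card B)) * x (ext_rank m B) ^ (k0 - card B) else 0))
      \<le> (?u choose k0) * (?n ^ snd t * (k0 choose fst t) * x (snd t) ^ (k0 - fst t))"
      unfolding t fst_conv snd_conv .
  qed
  also have "\<dots> = (?u choose k0) * (\<Sum>t\<in>rank_pairs m. ?n ^ snd t * (k0 choose fst t) * x (snd t) ^ (k0 - fst t))"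
    by (simp add: sum_distrib_left)
  also have "(\<Sum>t\<in>rank_pairs m. ?n ^ snd t * (k0 choose fst t) * x (snd t) ^ (k0 - fst t))
    = (\<Sum>(r, s)\<in>rank_pairs m. ?n ^ s * (k0 choose r) * (1 / (m * 2 ^ (s - 1)) + g) ^ (k0 - r))"
    unfolding x_def by (intro sum.cong) auto
  finally show ?thesis .
qed

text \<open>Joins the union bound over \<open>prime_auts\<close>, the charging with weight
  \<open>g\<close>, the averaging over samples and the sum just estimated;
  \<open>(order G - 1) choose k0\<close> then cancels. Assumption \<open>g2\<close> provides the
  weight condition with at least \<open>(1 - 1 / m) * order G\<close> moved points, and
  \<open>k0\<close> keeps \<open>k + k0\<close> below that number.\<close>

lemma bad_sets_bound_by_sampling:
  fixes g :: real
  assumes k: "k0 \<le> k" "2 * k \<le> order G" "k \<le> order G - 1" and g: "0 \<le> g" "g \<le> 1"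
    and g2: "real k0 + 1 \<le> 2 * ((1 - 1 / m) * order G - real k0) * g\<^sup>2"
    and k0: "order G / 2 + real k0 \<le> (1 - 1 / m) * order G"
  shows "real (card (bad_sets G k)) \<le> ((order G - 1) choose k) *
      (\<Sum>(r, s)\<in>rank_pairs m. order G ^ s * (k0 choose r) * (1 / (m * 2 ^ (s - 1)) + g) ^ (k0 - r))"
proof -
  let ?U = "carrier G - {\<one>}"
  let ?n = "order G"
  let ?u = "order G - 1"
  let ?Z = "\<Sum>(r, s)\<in>rank_pairs m. ?n ^ s * (k0 choose r) * (1 / (m * 2 ^ (s - 1)) + g) ^ (k0 - r)"
  have finU: "finite ?U" using fin by simp
  have cU: "card ?U = ?u" using card_nonid[OF fin] .
  have each: "real (card {R \<in> ksubs ?U k. f ` R = R}) * (?u choose k0)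
      \<le> (?u choose k) * (\<Sum>S\<in>ksubs ?U k0. g ^ card (S - (fixed_pts G f - {\<one>})))"
    if f: "f \<in> prime_auts G" for f
  proof -
    obtain p where "prime_period_map ?U f p (fixed_pts G f - {\<one>})"
      using prime_auts_period_map[OF fin f] by blast
    then interpret prime_period_map ?U f p "fixed_pts G f - {\<one>}" .
    have fa: "f \<in> auto G" using f unfolding prime_auts_def by simp
    define N where "N = card ?U - card (fixed_pts G f - {\<one>})"
    have "m * card (fixed_pts G f) \<le> ?n" using idx[OF fixed_pts_subgroup[OF fa] fixed_pts_proper[OF f]] .
    then have "real m * real (card (fixed_pts G f)) \<le> real ?n" by (metis of_nat_le_iff of_nat_mult)
    then have le: "real (card (fixed_pts G f)) \<le> real ?n / m" using m by (simp add: field_simps)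
    have "card (fixed_pts G f) \<le> ?n" unfolding fixed_pts_def order_def using fin by (intro card_mono) auto
    then have "real N = real ?n - real (card (fixed_pts G f))"
      unfolding N_def cU using card_fixed_nonid[OF fin fa] by simp
    then have N: "(1 - 1 / m) * ?n \<le> real N" using le by (simp add: field_simps)
    have 1: "1 \<le> real (N choose w) * g ^ (2 * min w k0)" if w: "w \<le> k" for w
    proof (rule choose_times_power_ge_one[OF g(1)])
      have "2 * ((1 - 1 / m) * ?n - real k0) * g\<^sup>2 \<le> 2 * (real N - real k0) * g\<^sup>2"
        using N by (intro mult_right_mono) auto
      then show "real k0 + 1 \<le> 2 * (real N - real k0) * g\<^sup>2" using g2 by linarith
      have "real k \<le> real ?n / 2" using k(2) by linarith
      then show "w + k0 \<le> N" using w N k0 by linarith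
    qed
    have "real (card (inv_sets k)) \<le> (\<Sum>R\<in>ksubs ?U k. g ^ min (card (R - (fixed_pts G f - {\<one>}))) k0)"
      using card_inv_sets_le_sum[OF g(1) 1[unfolded N_def]] .
    then have "real (card (inv_sets k)) * (card ?U choose k0)
        \<le> (\<Sum>R\<in>ksubs ?U k. g ^ min (card (R - (fixed_pts G f - {\<one>}))) k0) * (card ?U choose k0)"
      by (intro mult_right_mono) auto
    also have "\<dots> \<le> (card ?U choose k) * (\<Sum>S\<in>ksubs ?U k0. g ^ card (S - (fixed_pts G f - {\<one>})))"
      using k(3) cU by (intro sum_ksubs_average[OF finU k(1) _ g]) simp
    finally show ?thesis unfolding inv_sets_def cU .
  qed
  have "real (card (bad_sets G k)) * (?u choose k0)
      \<le> (\<Sum>f\<in>prime_auts G. real (card {R \<in> ksubs ?U k. f ` R = R})) * (?u choose k0)"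
    using of_nat_mono[OF card_bad_sets_le[OF fin, of k], where 'a = real] by (intro mult_right_mono) auto
  also have "\<dots> = (\<Sum>f\<in>prime_auts G. real (card {R \<in> ksubs ?U k. f ` R = R}) * (?u choose k0))"
    by (rule sum_distrib_right)
  also have "\<dots> \<le> (\<Sum>f\<in>prime_auts G. (?u choose k) * (\<Sum>S\<in>ksubs ?U k0. g ^ card (S - (fixed_pts G f - {\<one>}))))"
    using each by (rule sum_mono)
  also have "\<dots> = (?u choose k) * (\<Sum>f\<in>prime_auts G. \<Sum>S\<in>ksubs ?U k0. g ^ card (S - (fixed_pts G f - {\<one>})))"
    by (simp add: sum_distrib_left)
  also have "\<dots> \<le> (?u choose k) * ((?u choose k0) * ?Z)"
    using k by (intro mult_left_mono sum_over_prime_auts_le[OF g(1)]) auto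
  finally have "real (card (bad_sets G k)) * (?u choose k0) \<le> ((?u choose k) * ?Z) * (?u choose k0)"
    by (simp only: mult_ac)
  moreover have "0 < real (?u choose k0)" using k by simp
  ultimately show ?thesis by (simp only: mult_le_cancel_right_pos)
qed

end
end

section \<open>Groups of order less than 512\<close>

text \<open>Falling factorials avoid the division that makes binomial coefficients slow to simplify.\<close>

definition falling :: "nat \<Rightarrow> nat \<Rightarrow> nat" where
  "falling n k = fact k * (n choose k)"

lemma numeral_times_choose: "numeral v * (n choose numeral v) = n * ((n - 1) choose pred_numeral v)"
  using times_binomial_minus1_eq[of "numeral v" n] by (simp add: numeral_eq_Suc)

lemma choose_numeral: "(n choose numeral v) = n * ((n - 1) choose pred_numeral v) div numeral v"
  using numeral_times_choose by (metis nonzero_mult_div_cancel_left zero_neq_numeral)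

lemma falling_simps:
  "falling n 0 = 1" "falling n (Suc 0) = n"
  "falling n (numeral v) = n * falling (n - 1) (pred_numeral v)"
proof -
  show "falling n 0 = 1" "falling n (Suc 0) = n" by (simp_all add: falling_def)
  show "falling n (numeral v) = n * falling (n - 1) (pred_numeral v)"
    unfolding falling_def fact_numeral
    by (metis numeral_times_choose mult.assoc mult.left_commute of_nat_numeral)
qed

lemma less_choose_if_falling: "x * fact k < falling n k \<Longrightarrow> x < (n choose k)"
  unfolding falling_def by (simp add: mult.commute)

text \<open>The first five lines treat the orders 60-89, 90-120, 121-227, 228-372 and 373-511 with a
  prime divisor at least 5, the others the orders 72, 144, 216, 288 and 432. The exponents are
  \<open>2 * (t + 2) + 2\<close> for \<open>t + 2\<close> generators and \<open>n1 div m - 1\<close>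
  with minimal index \<open>m\<close>; the lower index is a \<open>k0\<close> with
  \<open>2 ^ k0 \<le> n0 ^ 5\<close>.\<close>

lemma numeral_choose_bounds:
  "89 ^ 6 * 2 ^ 16 < (59 choose 29 :: nat)"
  "120 ^ 6 * 2 ^ 23 < (89 choose 32 :: nat)"
  "227 ^ 8 * 2 ^ 36 < (120 choose 34 :: nat)"
  "372 ^ 10 * 2 ^ 61 < (227 choose 39 :: nat)"
  "511 ^ 10 * 2 ^ 84 < (372 choose 42 :: nat)"
  "72 ^ 8 * 2 ^ 13 < (71 choose 30 :: nat)"
  "144 ^ 10 * 2 ^ 23 < (143 choose 35 :: nat)"
  "216 ^ 12 * 2 ^ 35 < (215 choose 38 :: nat)"
  "288 ^ 12 * 2 ^ 47 < (287 choose 40 :: nat)"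
  "432 ^ 14 * 2 ^ 71 < (431 choose 43 :: nat)"
  by (rule less_choose_if_falling, simp add: falling_simps fact_numeral)+

text \<open>One comparison settles a whole interval: the left side grows with \<open>n\<close>, so
  \<open>n1\<close> is worst. On the right, \<open>2 ^ k0 \<le> n ^ 5 < 2 ^ (k + 1)\<close> gives
  \<open>k0 \<le> k\<close>, and the binomial coefficient grows in its lower index up to half of
  \<open>n - 1\<close>.\<close>

lemma power_lt_choose_interval:
  fixes n :: nat
  assumes n: "n0 \<le> n" "n \<le> n1" "0 < n0" and k0: "2 ^ k0 \<le> n0 ^ 5" and k: "n ^ 5 < 2 ^ (k + 1)" "2 * k + 1 \<le> n"
    and num: "n1 ^ e * 2 ^ (n1 div m - 1) < ((n0 - 1) choose k0)"
  shows "n ^ e * 2 ^ (n div m - 1) < ((n - 1) choose k)"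
proof -
  have "(2::nat) ^ k0 \<le> n0 ^ 5" by (rule k0)
  also have "\<dots> \<le> n ^ 5" using n by (intro power_mono) auto
  also have "\<dots> < 2 ^ (k + 1)" by (rule k)
  finally have "k0 < k + 1" by (rule power_less_imp_less_exp[rotated]) simp
  then have k0k: "k0 \<le> k" by simp
  have "n ^ e * 2 ^ (n div m - 1) \<le> n1 ^ e * 2 ^ (n1 div m - 1)"
    using n by (intro mult_mono power_mono power_increasing diff_le_mono div_le_mono) auto
  also have "\<dots> < ((n0 - 1) choose k0)" by (rule num)
  also have "\<dots> \<le> ((n - 1) choose k0)" using n by (intro binomial_right_mono) auto
  also have "\<dots> \<le> ((n - 1) choose k)" using k0k k by (intro binomial_mono) auto
  finally show ?thesis .
qed

lemma prime_ge_5: "Factorial_Ring.prime (p::nat) \<Longrightarrow> p \<noteq> 2 \<Longrightarrow> p \<noteq> 3 \<Longrightarrow> 5 \<le> p"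
proof (rule ccontr)
  assume p: "Factorial_Ring.prime p" "p \<noteq> 2" "p \<noteq> 3" "\<not> 5 \<le> p"
  then have "p = 4" using prime_ge_2_nat[OF p(1)] by linarith
  moreover have "(2::nat) dvd 4" by presburger
  ultimately show False using p(1) by (metis numeral_eq_iff one_eq_numeral_iff prime_nat_iff semiring_norm(83,85,87))
qed

context simple_group
begin

text \<open>Two elements already generate at least \<open>p\<^sup>2\<close> elements;
  \<open>t\<close> further ones extend them to a generating set.\<close>

lemma generators_from_prime:
  assumes fin: "finite (carrier G)" and nc: "\<not> comm_group G"
    and idx: "\<And>H. subgroup H G \<Longrightarrow> H \<noteq> carrier G \<Longrightarrow> m * card H \<le> order G"
    and p: "Factorial_Ring.prime p" "p dvd order G" and t: "order G < m * 2 ^ t * p\<^sup>2"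
  shows "\<exists>Y. Y \<subseteq> carrier G \<and> card Y \<le> t + 2 \<and> generate G Y = carrier G"
proof -
  obtain x y where xy: "x \<in> carrier G" "y \<in> carrier G" "p\<^sup>2 \<le> card (generate G {x, y})"
    using two_generated_square_le[OF fin nc p] by blast
  have "order G < m * 2 ^ t * card (generate G {x, y})"
    using t mult_left_mono[OF xy(3), of "m * 2 ^ t"] by (rule order_less_le_trans) simp
  then obtain Y where Y: "Y \<subseteq> carrier G" "card Y \<le> t" "generate G (generate G {x, y} \<union> Y) = carrier G"
    using extend_to_generating_set[OF fin idx generate_is_subgroup[of "{x, y}"]] xy by blast
  let ?Z = "{x, y} \<union> Y"
  have Z: "?Z \<subseteq> carrier G" using xy Y by auto
  have "generate G {x, y} \<subseteq> generate G ?Z" by (rule mono_generate) auto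
  moreover have "Y \<subseteq> generate G ?Z" by (auto intro: generate.incl)
  ultimately have "carrier G \<subseteq> generate G ?Z"
    using generate_subgroup_incl[OF _ generate_is_subgroup[OF Z], of "generate G {x, y} \<union> Y"] Y(3) by auto
  then have "generate G ?Z = carrier G" using generate_incl[OF Z] by auto
  moreover have "card ?Z \<le> t + 2"
  proof -
    have "card ?Z \<le> card {x, y} + card Y" by (rule card_Un_le)
    moreover have "card {x, y} \<le> 2" by (cases "x = y") auto
    ultimately show ?thesis using Y(2) by linarith
  qed
  ultimately show ?thesis using Z by blast
qed

text \<open>The lower bound \<open>q\<close> stands in for \<open>p\<close>, so that the numerical
  conditions do not mention the actual prime.\<close>

lemma bad_sets_bound_by_prime:
  assumes fin: "finite (carrier G)" and nc: "\<not> comm_group G"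
    and idx: "\<And>H. subgroup H G \<Longrightarrow> H \<noteq> carrier G \<Longrightarrow> m * card H \<le> order G" and m: "0 < m"
    and p: "Factorial_Ring.prime p" "p dvd order G" "q \<le> p" and t: "order G < m * 2 ^ t * q\<^sup>2"
    and n: "n0 \<le> order G" "order G \<le> n1" "0 < n0" and k0: "2 ^ k0 \<le> n0 ^ 5"
    and k: "order G ^ 5 < 2 ^ (k + 1)" "2 * k + 1 \<le> order G"
    and num: "n1 ^ (2 * (t + 2) + 2) * 2 ^ (n1 div m - 1) < ((n0 - 1) choose k0)"
  shows "card (bad_sets G k) * order G < ((order G - 1) choose k)"
proof -
  have "m * 2 ^ t * q\<^sup>2 \<le> m * 2 ^ t * p\<^sup>2" using p(3) by (intro mult_left_mono power_mono) auto
  then have "order G < m * 2 ^ t * p\<^sup>2" using t by linarith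
  then obtain Y where "Y \<subseteq> carrier G" "card Y \<le> t + 2" "generate G Y = carrier G"
    using generators_from_prime[OF fin nc idx p(1,2)] by blast
  then show ?thesis
    using bad_sets_bound_by_generators[OF fin idx m] power_lt_choose_interval[OF n k0 k num] by blast
qed

text \<open>A proper subgroup of order \<open>p ^ a\<close> has index at least 5. If
  \<open>p ^ a\<close> were the full order, a subgroup of index \<open>p\<close> would exist,
  contradicting \<open>p < 5\<close>.\<close>

lemma small_prime_power_index:
  assumes fin: "finite (carrier G)" and big: "24 < order G"
    and p: "Factorial_Ring.prime p" "p < 5" "p ^ a dvd order G"
  shows "5 * p ^ a \<le> order G"
proof -
  have sub: "5 * p ^ b \<le> order G" if b: "p ^ b dvd order G" "p ^ b \<noteq> order G" for b
  proof -
    obtain c where "order G = p ^ b * c" using b by (auto elim: dvdE)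
    then obtain H where H: "subgroup H G" "card H = p ^ b"
      using sylow_thm[OF p(1) is_group _ fin] by blast
    then have "H \<noteq> carrier G" using b unfolding order_def by auto
    moreover have "fact 4 < order G" using big by (simp add: fact_numeral)
    ultimately show ?thesis using index_ge[OF fin _ H(1), of 4] H(2) by simp
  qed
  show ?thesis
  proof (cases "p ^ a = order G")
    case False then show ?thesis using sub p by blast
  next
    case True
    then obtain b where b: "a = Suc b" using big by (cases a) auto
    have p0: "p > 1" using prime_gt_1_nat[OF p(1)] .
    have e: "order G = p * p ^ b" using True b by simp
    have "p ^ b dvd order G" "p ^ b \<noteq> order G" unfolding e using p0 by auto
    then have "5 * p ^ b \<le> p * p ^ b" using sub True b by simp
    then show ?thesis using p p0 by simp
  qed
qed

text \<open>Without a prime divisor above 3 the order is \<open>2 ^ a * 3 ^ b\<close>. Both prime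
  power parts have index at least 5, so each part is itself at least 5, which gives
  \<open>a \<ge> 3\<close> and \<open>b \<ge> 2\<close>; few such numbers are below 512.\<close>

lemma small_order_cases:
  assumes fin: "finite (carrier G)" and n: "24 < order G" "order G < 512"
  obtains p where "Factorial_Ring.prime p" "5 \<le> p" "p dvd order G"
    | "order G \<in> {72, 144, 216, 288, 432}"
proof -
  have n0: "order G \<noteq> 0" using n by simp
  obtain x where x: "order G = 2 ^ multiplicity 2 (order G) * x" "\<not> 2 dvd x"
    using multiplicity_decompose'[of "order G" 2] n0 by auto
  have x0: "x \<noteq> 0" using x(2) by (metis dvd_0_right)
  obtain y where y: "x = 3 ^ multiplicity 3 x * y" "\<not> 3 dvd y"
    using multiplicity_decompose'[of x 3] x0 by auto
  define a where "a = multiplicity 2 (order G)"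
  define b where "b = multiplicity 3 x"
  have dec: "order G = 2 ^ a * 3 ^ b * y" using x y unfolding a_def b_def by (metis mult.assoc)
  show thesis
  proof (cases "y = 1")
    case False
    obtain p where p: "Factorial_Ring.prime p" "p dvd y" using prime_factor_nat[OF False] by blast
    have "p \<noteq> 3" using p y by auto
    moreover have "p \<noteq> 2" using p x(2) y(1) by (metis dvd_mult)
    ultimately have "5 \<le> p" using prime_ge_5 p by blast
    then show thesis using that(1)[OF p(1)] p dec by simp
  next
    case True
    then have dec: "order G = 2 ^ a * 3 ^ b" using dec by simp
    have "5 * 2 ^ a \<le> order G" "5 * 3 ^ b \<le> order G"
      using small_prime_power_index[OF fin n(1), of 2 a] small_prime_power_index[OF fin n(1), of 3 b] dec by auto
    then have ab: "5 \<le> (3::nat) ^ b" "5 \<le> (2::nat) ^ a" unfolding dec by auto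
    have a3: "3 \<le> a"
    proof (rule ccontr)
      assume "\<not> 3 \<le> a" then have "a = 0 \<or> a = 1 \<or> a = 2" by linarith
      then show False using ab(2) by auto
    qed
    have b2: "2 \<le> b"
    proof (rule ccontr)
      assume "\<not> 2 \<le> b" then have "b = 0 \<or> b = 1" by linarith
      then show False using ab(1) by auto
    qed
    have b3: "b < 4"
    proof (rule ccontr)
      assume "\<not> b < 4"
      then have "(3::nat) ^ 4 \<le> 3 ^ b" by (intro power_increasing) auto
      moreover have "(2::nat) ^ 3 \<le> 2 ^ a" using a3 by (intro power_increasing) auto
      ultimately have "(2::nat) ^ 3 * 3 ^ 4 \<le> order G" unfolding dec by (rule mult_le_mono[rotated])
      then show False using n by simp
    qed
    have a6: "a < 6"
    proof (rule ccontr)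
      assume "\<not> a < 6"
      then have "(2::nat) ^ 6 \<le> 2 ^ a" by (intro power_increasing) auto
      moreover have "(3::nat) ^ 2 \<le> 3 ^ b" using b2 by (intro power_increasing) auto
      ultimately have "(2::nat) ^ 6 * 3 ^ 2 \<le> order G" unfolding dec by (rule mult_le_mono)
      then show False using n by simp
    qed
    have "a = 3 \<or> a = 4 \<or> a = 5" "b = 2 \<or> b = 3" using a3 a6 b2 b3 by auto
    \<comment> \<open>The remaining combination \<open>a = 5\<close>, \<open>b = 3\<close> gives 864
      and is excluded by the upper bound.\<close>
    then have "order G \<in> {72, 144, 216, 288, 432}" using n(2) unfolding dec by (elim disjE) simp_all
    then show thesis by (rule that(2))
  qed
qed

lemma bad_sets_bound_small:
  assumes fin: "finite (carrier G)" and nc: "\<not> comm_group G" and n: "60 \<le> order G" "order G < 512"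
    and k: "order G ^ 5 < 2 ^ (k + 1)" "2 * k + 1 \<le> order G"
  shows "card (bad_sets G k) * order G < ((order G - 1) choose k)"
proof -
  have idx5: "5 * card H \<le> order G" if "subgroup H G" "H \<noteq> carrier G" for H
    using index_ge[OF fin _ that, of 4] n by (simp add: fact_numeral)
  have idx6: "6 * card H \<le> order G" if "subgroup H G" "H \<noteq> carrier G" "120 < order G" for H
    using index_ge[OF fin _ that(1,2), of 5] that(3) by (simp add: fact_numeral)
  have n24: "24 < order G" using n by simp
  show ?thesis
  proof (rule small_order_cases[OF fin n24 n(2)])
    fix p assume p: "Factorial_Ring.prime p" "5 \<le> p" "p dvd order G"
    \<comment> \<open>Two generators suffice below 5 * 25 = 125; index 6 is available above 120 and
      gives three generators below 300 and four below 600.\<close>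
    consider "order G \<le> 89" | "90 \<le> order G" "order G \<le> 120" | "121 \<le> order G" "order G \<le> 227"
      | "228 \<le> order G" "order G \<le> 372" | "373 \<le> order G" "order G \<le> 511" using n by linarith
    then show ?thesis
    proof cases
      case 1
      show ?thesis
        by (rule bad_sets_bound_by_prime[where t = 0 and ?k0.0 = 29, OF fin nc idx5 _ p(1,3,2) _ n(1) 1 _ _ k])
           (use 1 numeral_choose_bounds(1) in \<open>simp_all\<close>)
    next
      case 2
      show ?thesis
        by (rule bad_sets_bound_by_prime[where t = 0 and ?k0.0 = 32, OF fin nc idx5 _ p(1,3,2) _ 2 _ _ k])
           (use 2 numeral_choose_bounds(2) in \<open>simp_all\<close>)
    next
      case 3
      show ?thesis
        by (rule bad_sets_bound_by_prime[where t = 1 and ?k0.0 = 34, OF fin nc idx6 _ p(1,3,2) _ 3 _ _ k])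
           (use 3 numeral_choose_bounds(3) in \<open>simp_all\<close>)
    next
      case 4
      show ?thesis
        by (rule bad_sets_bound_by_prime[where t = 2 and ?k0.0 = 39, OF fin nc idx6 _ p(1,3,2) _ 4 _ _ k])
           (use 4 numeral_choose_bounds(4) in \<open>simp_all\<close>)
    next
      case 5
      show ?thesis
        by (rule bad_sets_bound_by_prime[where t = 2 and ?k0.0 = 42, OF fin nc idx6 _ p(1,3,2) _ 5 _ _ k])
           (use 5 numeral_choose_bounds(5) in \<open>simp_all\<close>)
    qed
  next
    assume "order G \<in> {72, 144, 216, 288, 432}"
    then consider "order G = 72" | "order G = 144" | "order G = 216" | "order G = 288" | "order G = 432" by auto
    then show ?thesis
    proof cases
      case 1
      show ?thesis
        by (rule bad_sets_bound_by_prime[where p = 3 and t = 1 and ?k0.0 = 30, OF fin nc idx5 _ _ _ order_refl _ order_refl order_refl _ _ k])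
           (use 1 numeral_choose_bounds(6) in \<open>simp_all\<close>)
    next
      case 2
      show ?thesis
        by (rule bad_sets_bound_by_prime[where p = 3 and t = 2 and ?k0.0 = 35, OF fin nc idx6 _ _ _ order_refl _ order_refl order_refl _ _ k])
           (use 2 numeral_choose_bounds(7) in \<open>simp_all\<close>)
    next
      case 3
      show ?thesis
        by (rule bad_sets_bound_by_prime[where p = 3 and t = 3 and ?k0.0 = 38, OF fin nc idx6 _ _ _ order_refl _ order_refl order_refl _ _ k])
           (use 3 numeral_choose_bounds(8) in \<open>simp_all\<close>)
    next
      case 4
      show ?thesis
        by (rule bad_sets_bound_by_prime[where p = 3 and t = 3 and ?k0.0 = 40, OF fin nc idx6 _ _ _ order_refl _ order_refl order_refl _ _ k])
           (use 4 numeral_choose_bounds(9) in \<open>simp_all\<close>)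
    next
      case 5
      show ?thesis
        by (rule bad_sets_bound_by_prime[where p = 3 and t = 4 and ?k0.0 = 43, OF fin nc idx6 _ _ _ order_refl _ order_refl order_refl _ _ k])
           (use 5 numeral_choose_bounds(10) in \<open>simp_all\<close>)
    qed
  qed
qed

end

section \<open>Groups of order at least 512\<close>

text \<open>Here \<open>g\<close> bounds the cost of a sampled point that is moved, \<open>s\<close> is the number of
  generators missing from the subgroup \<open>K\<close> generated by the sampled fixed points, and
  \<open>1 / (3 * 2 ^ s) = 1 / (6 * 2 ^ (s - 1))\<close> bounds the density of \<open>K\<close>.\<close>

definition tail_term :: "nat \<Rightarrow> nat \<Rightarrow> nat \<Rightarrow> real \<Rightarrow> nat \<Rightarrow> real" where
  "tail_term n k0 D g s =
    real n ^ (s + 1) * real (\<Sum>r\<le>D - s. k0 choose r) * (1 / (3 * 2 ^ s) + g) ^ (k0 - (D - s))"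

lemma tail_term_nonneg: "0 \<le> g \<Longrightarrow> 0 \<le> tail_term n k0 D g s"
  unfolding tail_term_def by (intro mult_nonneg_nonneg zero_le_power of_nat_0_le_iff) simp

lemma tail_term_mono: "n \<le> n' \<Longrightarrow> 0 \<le> g \<Longrightarrow> tail_term n k0 D g s \<le> tail_term n' k0 D g s"
  unfolding tail_term_def
  by (intro mult_right_mono power_mono zero_le_power of_nat_0_le_iff of_nat_mono) simp_all

text \<open>A rank pair satisfies \<open>6 * 2 ^ (s - 1 + r) \<le> order G < 6 * 2 ^ D\<close>,
  hence \<open>r \<le> D - s\<close>. As the base is at most 1, every exponent \<open>k0 - r\<close>
  may be lowered to \<open>k0 - (D - s)\<close>. The outer factor \<open>order G\<close> raises the
  power from \<open>s\<close> to \<open>s + 1\<close>.\<close>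

lemma (in group) sum_rank_pairs_le:
  fixes g :: real
  assumes D: "order G < 6 * 2 ^ D" "D \<le> k0" and g: "0 \<le> g" "g \<le> 5 / 6"
  shows "order G * (\<Sum>(r, s)\<in>rank_pairs 6. order G ^ s * (k0 choose r) * (1 / (6 * 2 ^ (s - 1)) + g) ^ (k0 - r))
    \<le> (\<Sum>s\<in>{1..D}. tail_term (order G) k0 D g s)"
proof -
  define x where "x s = 1 / (3 * 2 ^ s) + g" for s :: nat
  have x0: "0 \<le> x s" for s using g unfolding x_def by simp
  have x1: "x s \<le> 1" if "1 \<le> s" for s
  proof -
    have "(2::real) ^ 1 \<le> 2 ^ s" using that by (intro power_increasing) auto
    then have "1 / (3 * 2 ^ s) \<le> 1 / (6::real)" by (intro divide_left_mono) auto
    then show ?thesis using g unfolding x_def by linarith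
  qed
  have x_alt: "1 / (6 * 2 ^ (s - 1)) + g = x s" if "1 \<le> s" for s
    using that unfolding x_def by (cases s) auto
  let ?f = "\<lambda>(r, s). real (order G) ^ s * (k0 choose r) * x s ^ (k0 - r)"
  have sub: "rank_pairs 6 \<subseteq> (\<lambda>(s, r). (r, s)) ` (SIGMA s:{1..D}. {..D - s})"
  proof
    fix t assume "t \<in> rank_pairs 6"
    then obtain r s where t: "t = (r, s)" "1 \<le> s" "6 * 2 ^ (s - 1) * 2 ^ r \<le> order G"
      unfolding rank_pairs_def by auto
    have "6 * (2::nat) ^ (s - 1 + r) = 6 * 2 ^ (s - 1) * 2 ^ r" by (simp add: power_add)
    then have "6 * (2::nat) ^ (s - 1 + r) < 6 * 2 ^ D" using D(1) t(3) by linarith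
    then have "(2::nat) ^ (s - 1 + r) < 2 ^ D" by linarith
    then have "s - 1 + r < D" by (rule power_less_imp_less_exp[rotated]) simp
    then show "t \<in> (\<lambda>(s, r). (r, s)) ` (SIGMA s:{1..D}. {..D - s})"
      using t by (intro image_eqI[of _ _ "(s, r)"]) auto
  qed
  have "(\<Sum>(r, s)\<in>rank_pairs 6. order G ^ s * (k0 choose r) * (1 / (6 * 2 ^ (s - 1)) + g) ^ (k0 - r))
      = (\<Sum>t\<in>rank_pairs 6. ?f t)"
  proof (rule sum.cong[OF refl], clarify)
    fix r s assume "(r, s) \<in> rank_pairs 6"
    then have "1 \<le> s" unfolding rank_pairs_def by simp
    then show "order G ^ s * (k0 choose r) * (1 / (6 * 2 ^ (s - 1)) + g) ^ (k0 - r)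
      = real (order G) ^ s * (k0 choose r) * x s ^ (k0 - r)"
      by (simp add: x_alt[unfolded One_nat_def])
  qed
  also have "\<dots> \<le> (\<Sum>t\<in>(\<lambda>(s, r). (r, s)) ` (SIGMA s:{1..D}. {..D - s}). ?f t)"
    using x0 by (intro sum_mono2 sub) auto
  also have "\<dots> = (\<Sum>(s, r)\<in>(SIGMA s:{1..D}. {..D - s}). real (order G) ^ s * (k0 choose r) * x s ^ (k0 - r))"
    by (subst sum.reindex) (auto simp: inj_on_def comp_def case_prod_beta)
  also have "\<dots> = (\<Sum>s\<in>{1..D}. \<Sum>r\<le>D - s. real (order G) ^ s * (k0 choose r) * x s ^ (k0 - r))"
    by (rule sum.Sigma[symmetric]) auto
  also have "\<dots> \<le> (\<Sum>s\<in>{1..D}. \<Sum>r\<le>D - s. real (order G) ^ s * (k0 choose r) * x s ^ (k0 - (D - s)))"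
  proof (intro sum_mono mult_left_mono power_decreasing)
    fix s r assume s: "s \<in> {1..D}" "r \<in> {..D - s}"
    show "x s \<le> 1" using x1 s by simp
    show "k0 - (D - s) \<le> k0 - r" using s by (intro diff_le_mono2) simp
  qed (use x0 in auto)
  also have "\<dots> = (\<Sum>s\<in>{1..D}. real (order G) ^ s * real (\<Sum>r\<le>D - s. k0 choose r) * x s ^ (k0 - (D - s)))"
    by (simp add: sum_distrib_left sum_distrib_right)
  finally have "order G * (\<Sum>(r, s)\<in>rank_pairs 6. order G ^ s * (k0 choose r) * (1 / (6 * 2 ^ (s - 1)) + g) ^ (k0 - r))
    \<le> order G * (\<Sum>s\<in>{1..D}. real (order G) ^ s * real (\<Sum>r\<le>D - s. k0 choose r) * x s ^ (k0 - (D - s)))"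
    by (rule mult_left_mono) simp
  also have "\<dots> = (\<Sum>s\<in>{1..D}. tail_term (order G) k0 D g s)"
    unfolding sum_distrib_left tail_term_def x_def
    by (rule sum.cong[OF refl]) (simp only: power_add power_one_right mult_ac)
  finally show ?thesis .
qed

text \<open>Here too the endpoints of an interval of orders decide: the conditions on
  \<open>k0\<close> and \<open>g\<close> are worst at \<open>n0\<close>, the tail terms at
  \<open>n1\<close>.\<close>

lemma (in simple_group) bad_sets_bound_large:
  fixes g :: real
  assumes fin: "finite (carrier G)" and big: "120 < order G"
    and n: "n0 \<le> order G" "order G \<le> n1" "n1 < 6 * 2 ^ D" "D \<le> k0" "0 < n0"
    and k0: "2 ^ k0 \<le> n0 ^ 5" "3 * k0 \<le> n0"
    and k: "order G ^ 5 < 2 ^ (k + 1)" "2 * k + 1 \<le> order G"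
    and g: "0 \<le> g" "g \<le> 5 / 6" "real k0 + 1 \<le> 2 * (5 / 6 * real n0 - real k0) * g\<^sup>2"
    and num: "(\<Sum>s\<in>{1..D}. tail_term n1 k0 D g s) < 1"
  shows "card (bad_sets G k) * order G < ((order G - 1) choose k)"
proof -
  let ?Z = "\<Sum>(r, s)\<in>rank_pairs 6. order G ^ s * (k0 choose r) * (1 / (6 * 2 ^ (s - 1)) + g) ^ (k0 - r)"
  let ?B = "(order G - 1) choose k"
  have idx6: "6 * card H \<le> order G" if "subgroup H G" "H \<noteq> carrier G" for H
    using index_ge[OF fin _ that, of 5] big by (simp add: fact_numeral)
  have "(2::nat) ^ k0 \<le> order G ^ 5" using k0(1) power_mono[OF n(1), of 5] by linarith
  also have "\<dots> < 2 ^ (k + 1)" by (rule k)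
  finally have "k0 < k + 1" by (rule power_less_imp_less_exp[rotated]) simp
  then have k0k: "k0 \<le> k" by simp
  have n0n: "real n0 \<le> real (order G)" using n(1) by simp
  have "2 * (5 / 6 * real n0 - real k0) * g\<^sup>2 \<le> 2 * (5 / 6 * real (order G) - real k0) * g\<^sup>2"
    using n0n by (intro mult_right_mono) auto
  then have g2: "real k0 + 1 \<le> 2 * ((1 - 1 / real 6) * real (order G) - real k0) * g\<^sup>2" using g(3) by simp
  \<comment> \<open>The bound \<open>3 * k0 \<le> n0\<close> is what remains, since 1 - 1/6 - 1/2 =
    1/3.\<close>
  have k03: "real (order G) / 2 + real k0 \<le> (1 - 1 / real 6) * real (order G)"
    using k0(2) n(1) by simp
  have Z: "real (card (bad_sets G k)) \<le> ?B * ?Z"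
    using bad_sets_bound_by_sampling[OF fin _ idx6 k0k _ _ g(1) _ g2 k03] k(2) g(2) by simp
  have "order G * ?Z \<le> (\<Sum>s\<in>{1..D}. tail_term (order G) k0 D g s)"
    using n by (intro sum_rank_pairs_le g(1,2)) auto
  also have "\<dots> \<le> (\<Sum>s\<in>{1..D}. tail_term n1 k0 D g s)"
    using n g by (intro sum_mono tail_term_mono) auto
  also have "\<dots> < 1" by (rule num)
  finally have Z1: "order G * ?Z < 1" .
  have B0: "0 < real ?B" using k(2) by simp
  have "real (card (bad_sets G k)) * order G \<le> (?B * ?Z) * order G"
    using Z by (intro mult_right_mono) auto
  also have "\<dots> = ?B * (order G * ?Z)" by (simp only: mult_ac)
  also have "\<dots> < real ?B * 1" using Z1 B0 by (rule mult_strict_left_mono)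
  finally show ?thesis by (metis mult.right_neutral of_nat_less_iff of_nat_mult)
qed

section \<open>Estimates for orders from \<open>2 ^ 16\<close> on\<close>

lemma sum_choose_le:
  assumes "R \<le> N"
  shows "real (\<Sum>r\<le>R. N choose r) \<le> 4 ^ R * (5 / 4) ^ N"
proof -
  have "real (\<Sum>r\<le>R. N choose r) = (\<Sum>r\<le>R. real (N choose r))" by simp
  \<comment> \<open>Each summand is multiplied by \<open>4 ^ (R - r)\<close>, which is at least 1;
    extending the sum to all \<open>r \<le> N\<close> then gives the full expansion of
    \<open>(1 / 4 + 1) ^ N\<close>.\<close>
  also have "\<dots> \<le> (\<Sum>r\<le>R. 4 ^ R * (real (N choose r) * (1 / 4) ^ r))"
  proof (rule sum_mono)
    fix r assume "r \<in> {..R}"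
    then have "(4::real) ^ R * (1 / 4) ^ r = 4 ^ (R - r)"
      by (simp add: power_diff power_one_over field_simps)
    moreover have "1 \<le> (4::real) ^ (R - r)" by simp
    ultimately have "real (N choose r) * 1 \<le> real (N choose r) * (4 ^ R * (1 / 4) ^ r)"
      by (intro mult_left_mono) auto
    then show "real (N choose r) \<le> 4 ^ R * (real (N choose r) * (1 / 4) ^ r)" by (simp add: mult_ac)
  qed
  also have "\<dots> = 4 ^ R * (\<Sum>r\<le>R. real (N choose r) * (1 / 4) ^ r)" by (simp add: sum_distrib_left)
  also have "\<dots> \<le> 4 ^ R * (\<Sum>r\<le>N. real (N choose r) * (1 / 4) ^ r)"
    using assms by (intro mult_left_mono sum_mono2) auto
  also have "(\<Sum>r\<le>N. real (N choose r) * (1 / 4) ^ r) = (5 / 4) ^ N"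
    using binomial_ring[of "1 / 4 :: real" 1 N] by simp
  finally show ?thesis .
qed

lemma power4_le_imp_le: "a ^ 4 \<le> b ^ 4 \<Longrightarrow> 0 \<le> b \<Longrightarrow> a \<le> b" for a b :: real
  using power_le_imp_le_base[of a 3 b] by (simp add: eval_nat_numeral)

text \<open>Fourth powers are used because \<open>g ^ 4\<close> is rational. For
  \<open>s \<le> 5\<close> the bound \<open>g \<le> 3 / 100\<close> leaves five numerical checks.
  For larger \<open>s\<close> the larger summand dominates: if \<open>g\<close> is at least 20 times
  the other, the decisive fact is (21/20)^4 / 40 <= 1/32; otherwise the sum is at most 21 / (3 *
  2^s) = 7 / 2^s, and 2401 = 7^4.\<close>

lemma tail_base_le:
  fixes g :: real
  assumes j: "16 \<le> j" and s: "1 \<le> s" "s + 1 \<le> j" and g: "0 \<le> g" "g ^ 4 = 1 / (20 * 2 ^ j)"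
  shows "(1 / (3 * 2 ^ s) + g) ^ 4 \<le> 1 / 2 ^ (s + 5)"
proof -
  define a :: real where "a = 1 / (3 * 2 ^ s)"
  have a0: "0 < a" unfolding a_def by simp
  have a4: "a ^ 4 = 1 / (81 * (2 ^ s) ^ 4)" unfolding a_def by (simp add: power_divide power_mult_distrib)
  show ?thesis
  proof (cases "s \<le> 5")
    case True
    have "(2::real) ^ 16 \<le> 2 ^ j" using j by (intro power_increasing) auto
    then have "g ^ 4 \<le> 1 / (20 * 2 ^ 16)" unfolding g(2) by (intro divide_left_mono) auto
    also have "\<dots> \<le> (3 / 100 :: real) ^ 4" by (simp add: power_divide)
    finally have "g \<le> 3 / 100" by (rule power4_le_imp_le) simp
    then have le: "(a + g) ^ 4 \<le> (a + 3 / 100) ^ 4" using a0 g(1) by (intro power_mono) auto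
    have "s = 1 \<or> s = 2 \<or> s = 3 \<or> s = 4 \<or> s = 5" using True s by linarith
    then have "(a + 3 / 100) ^ 4 \<le> 1 / 2 ^ (s + 5)" unfolding a_def by (elim disjE) (simp_all add: power_divide)
    then show ?thesis using le unfolding a_def by linarith
  next
    case False
    show ?thesis
    proof (cases "20 * a \<le> g")
      case True
      then have "(a + g) ^ 4 \<le> (21 / 20 * g) ^ 4" using a0 g(1) by (intro power_mono) auto
      also have "\<dots> = (21 / 20) ^ 4 * (1 / (20 * 2 ^ j))" unfolding power_mult_distrib g(2) ..
      also have "\<dots> \<le> (21 / 20) ^ 4 * (1 / (20 * 2 ^ (s + 1)))"
        using s by (intro mult_left_mono divide_left_mono power_increasing) auto
      also have "\<dots> \<le> 1 / 2 ^ (s + 5)" by (simp add: power_add power_divide field_simps)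
      finally show ?thesis unfolding a_def .
    next
      case f: False
      have "(a + g) ^ 4 \<le> (21 * a) ^ 4" using f a0 g(1) by (intro power_mono) auto
      also have "\<dots> = 2401 / (2 ^ s) ^ 4" unfolding power_mult_distrib a4 by simp
      also have "\<dots> \<le> 1 / 2 ^ (s + 5)"
      proof -
        have "(2::real) ^ 6 \<le> 2 ^ s" using False by (intro power_increasing) auto
        then have "(2 ^ 6) ^ 3 \<le> ((2::real) ^ s) ^ 3" by (rule power_mono) simp
        then have "2401 * 2 ^ 5 \<le> ((2::real) ^ s) ^ 3" by simp
        then have "(2401 * 2 ^ 5) * (2::real) ^ s \<le> (2 ^ s) ^ 3 * 2 ^ s" by (intro mult_right_mono) auto
        then have "2401 * (2::real) ^ (s + 5) \<le> (2 ^ s) ^ 4" by (simp add: power_add eval_nat_numeral mult_ac)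
        then show ?thesis by (simp add: field_simps)
      qed
      finally show ?thesis unfolding a_def .
    qed
  qed
qed

text \<open>After raising to the fourth power every factor is bounded by a power of 2, and only
  exponents have to be compared.\<close>

lemma tail_term_le:
  fixes g :: real
  assumes j: "16 \<le> j" and s: "1 \<le> s" "s \<le> j - 1" and g: "0 \<le> g" "g ^ 4 = 1 / (20 * 2 ^ j)"
  shows "tail_term (2 ^ (j + 1)) (5 * j) (j - 1) g s \<le> 1 / 2 ^ (s + 1)"
proof -
  define R where "R = j - 1 - s"
  define x where "x = 1 / (3 * 2 ^ s) + g"
  have jR: "j = s + 1 + R" unfolding R_def using s j by linarith
  have e: "5 * j - R = 4 * j + 1 + s" unfolding R_def using s j by linarith
  have x0: "0 \<le> x" unfolding x_def using g by simp
  have x4: "x ^ 4 \<le> 1 / 2 ^ (s + 5)" unfolding x_def using tail_base_le[OF j s(1) _ g] s j by simp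
  have S: "real (\<Sum>r\<le>R. (5 * j) choose r) \<le> 4 ^ R * (5 / 4) ^ (5 * j)"
    by (rule sum_choose_le) (simp add: jR)
  let ?t = "tail_term (2 ^ (j + 1)) (5 * j) (j - 1) g s"
  have "?t = (2 ^ (j + 1)) ^ (s + 1) * real (\<Sum>r\<le>R. (5 * j) choose r) * x ^ (4 * j + 1 + s)"
    unfolding tail_term_def R_def[symmetric] x_def[symmetric] e by simp
  also have "\<dots> \<le> (2 ^ (j + 1)) ^ (s + 1) * (4 ^ R * (5 / 4) ^ (5 * j)) * x ^ (4 * j + 1 + s)"
    using S x0 by (intro mult_right_mono mult_left_mono) auto
  finally have "?t ^ 4 \<le> ((2 ^ (j + 1)) ^ (s + 1) * (4 ^ R * (5 / 4) ^ (5 * j)) * x ^ (4 * j + 1 + s)) ^ 4"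
    by (rule power_mono) (rule tail_term_nonneg[OF g(1)])
  also have "\<dots> = 2 ^ (4 * (j + 1) * (s + 1)) * (2 ^ (8 * R) * ((5 / 4) ^ 20) ^ j) * (x ^ 4) ^ (4 * j + 1 + s)"
  proof -
    have "((2::real) ^ (j + 1)) ^ (s + 1) = 2 ^ ((j + 1) * (s + 1))" by (rule power_mult[symmetric])
    moreover have "(4::real) ^ R = 2 ^ (2 * R)" by (simp add: power_mult)
    ultimately show ?thesis
      by (simp only: power_mult_distrib power_mult[symmetric]) (simp only: mult_ac, simp)
  qed
  also have "\<dots> \<le> 2 ^ (4 * (j + 1) * (s + 1)) * (2 ^ (8 * R) * (2 ^ 7) ^ j) * (1 / 2 ^ (s + 5)) ^ (4 * j + 1 + s)"
  proof -
    \<comment> \<open>Numerically (5/4)^20 is about 87, below 128.\<close>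
    have "((5 / 4) ^ 20) ^ j \<le> ((2::real) ^ 7) ^ j" by (rule power_mono) (simp_all add: power_divide)
    moreover have "(x ^ 4) ^ (4 * j + 1 + s) \<le> (1 / 2 ^ (s + 5)) ^ (4 * j + 1 + s)"
      using x4 x0 by (intro power_mono) auto
    ultimately show ?thesis using x0 by (intro mult_mono mult_left_mono mult_nonneg_nonneg zero_le_power) auto
  qed
  also have "\<dots> = 2 ^ (4 * (j + 1) * (s + 1) + 8 * R + 7 * j) / 2 ^ ((s + 5) * (4 * j + 1 + s))"
    by (simp only: power_add power_mult power_one_over) (simp add: field_simps power_mult)
  also have "\<dots> \<le> 1 / 2 ^ (4 * (s + 1))"
  proof -
    \<comment> \<open>With \<open>R = j - 1 - s\<close> the right side exceeds the left by j + s^2 +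
      6*s + 5.\<close>
    have "4 * (j + 1) * (s + 1) + 8 * R + 7 * j + 4 * (s + 1) \<le> (s + 5) * (4 * j + 1 + s)"
      unfolding jR by (simp add: algebra_simps)
    then have "(2::real) ^ (4 * (j + 1) * (s + 1) + 8 * R + 7 * j + 4 * (s + 1)) \<le> 2 ^ ((s + 5) * (4 * j + 1 + s))"
      by (intro power_increasing) auto
    then have "(2::real) ^ (4 * (j + 1) * (s + 1) + 8 * R + 7 * j) * 2 ^ (4 * (s + 1)) \<le> 2 ^ ((s + 5) * (4 * j + 1 + s))"
      by (simp only: power_add)
    then show ?thesis by (simp only: divide_le_eq zero_less_power zero_less_numeral pos_le_divide_eq pos_divide_le_eq mult_1 times_divide_eq_left if_True)
  qed
  also have "\<dots> = (1 / 2 ^ (s + 1)) ^ 4" by (simp only: power_one_over power_mult[symmetric] mult.commute)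
  finally show ?thesis by (rule power4_le_imp_le) simp
qed

lemma sum_halves_less_one: "(\<Sum>s\<in>{1..D}. 1 / 2 ^ (s + 1)) < (1::real)"
proof -
  have "(\<Sum>s\<in>{1..D}. 1 / 2 ^ (s + 1)) = 1 / 2 - 1 / (2::real) ^ (D + 1)"
    by (induction D) (simp_all add: field_simps)
  moreover have "0 < 1 / (2::real) ^ (D + 1)" by simp
  ultimately show ?thesis by linarith
qed

text \<open>From one \<open>j\<close> to the next the square at most doubles. The constants 73 and
  10 are those needed for the condition on \<open>g\<close> in
  \<open>bad_sets_bound_huge\<close>.\<close>

lemma poly_le_two_power: "16 \<le> j \<Longrightarrow> 73 * (5 * j + 1)\<^sup>2 \<le> 10 * (2::nat) ^ j"
proof (induction j rule: dec_induct)
  case base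
  then show ?case by simp
next
  case (step j)
  have "(5 * Suc j + 1)\<^sup>2 \<le> 2 * (5 * j + 1)\<^sup>2"
  proof -
    have "40 * j + 34 \<le> 25 * j * j"
    proof -
      have "25 * 16 * j \<le> 25 * j * j" using step by simp
      then show ?thesis using step by linarith
    qed
    then show ?thesis by (simp add: power2_eq_square algebra_simps)
  qed
  then show ?case using step by simp
qed

text \<open>The arguments are upper endpoint, sample size \<open>k0\<close>, \<open>D\<close> and
  \<open>g\<close> for the orders 512-639, 640-1023 and the dyadic blocks from \<open>2 ^ 10\<close>
  to \<open>2 ^ 16\<close>. Each \<open>g\<close> is chosen small subject to \<open>real k0 + 1
  \<le> 2 * (5 / 6 * real n0 - real k0) * g\<^sup>2\<close>. At most 14 terms of size 1/64 add up to
  less than 1.\<close>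

lemma tail_term_numeral:
  "list_all (\<lambda>s. tail_term 639 45 7 (1 / 4) s \<le> 1 / 64) [1, 2, 3, 4, 5, 6, 7]"
  "list_all (\<lambda>s. tail_term 1023 46 8 (2 / 9) s \<le> 1 / 64) [1, 2, 3, 4, 5, 6, 7, 8]"
  "list_all (\<lambda>s. tail_term (2 ^ 11) 50 9 (9 / 50) s \<le> 1 / 64) [1, 2, 3, 4, 5, 6, 7, 8, 9]"
  "list_all (\<lambda>s. tail_term (2 ^ 12) 55 10 (2 / 15) s \<le> 1 / 64) [1, 2, 3, 4, 5, 6, 7, 8, 9, 10]"
  "list_all (\<lambda>s. tail_term (2 ^ 13) 60 11 (1 / 10) s \<le> 1 / 64) [1, 2, 3, 4, 5, 6, 7, 8, 9, 10, 11]"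
  "list_all (\<lambda>s. tail_term (2 ^ 14) 65 12 (1 / 14) s \<le> 1 / 64) [1, 2, 3, 4, 5, 6, 7, 8, 9, 10, 11, 12]"
  "list_all (\<lambda>s. tail_term (2 ^ 15) 70 13 (1 / 19) s \<le> 1 / 64) [1, 2, 3, 4, 5, 6, 7, 8, 9, 10, 11, 12, 13]"
  "list_all (\<lambda>s. tail_term (2 ^ 16) 75 14 (1 / 26) s \<le> 1 / 64) [1, 2, 3, 4, 5, 6, 7, 8, 9, 10, 11, 12, 13, 14]"
  by (simp add: tail_term_def atMost_nat_numeral choose_numeral power_divide)+

lemma sum_tail_less_one:
  fixes t :: "nat \<Rightarrow> real"
  assumes "list_all (\<lambda>s. t s \<le> 1 / 64) xs" "xs = [1..<Suc D]" "D < 64"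
  shows "(\<Sum>s\<in>{1..D}. t s) < 1"
proof -
  have "set xs = {1..D}" unfolding assms(2) set_upt by auto
  then have "(\<Sum>s\<in>{1..D}. t s) \<le> (\<Sum>s\<in>{1..D}. 1 / 64)"
    using assms(1) unfolding list_all_iff by (intro sum_mono) blast
  also have "\<dots> < 1" using assms(3) by simp
  finally show ?thesis .
qed

lemma two_power_interval:
  assumes "1 \<le> (n::nat)"
  obtains j where "2 ^ j \<le> n" "n < 2 ^ (j + 1)"
  using ex_power_ivl1[of 2 n] assms by auto

context simple_group
begin

text \<open>On a dyadic block the natural choices are \<open>k0 = 5 * j\<close>, for which
  \<open>2 ^ k0\<close> equals the fifth power of the lower endpoint, and \<open>D = j - 1\<close>,
  since \<open>6 * 2 ^ (j - 1)\<close> is \<open>3 * 2 ^ j\<close>.\<close>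

lemma bad_sets_bound_dyadic:
  fixes g :: real
  assumes fin: "finite (carrier G)" and big: "120 < order G" and j: "2 ^ j \<le> order G" "order G < 2 ^ (j + 1)"
    and k: "order G ^ 5 < 2 ^ (k + 1)" "2 * k + 1 \<le> order G" and j1: "1 \<le> j" "15 * j \<le> 2 ^ j"
    and g: "0 \<le> g" "g \<le> 5 / 6" "5 * real j + 1 \<le> 2 * (5 / 6 * 2 ^ j - 5 * real j) * g\<^sup>2"
    and num: "(\<Sum>s\<in>{1..j - 1}. tail_term (2 ^ (j + 1)) (5 * j) (j - 1) g s) < 1"
  shows "card (bad_sets G k) * order G < ((order G - 1) choose k)"
proof (rule bad_sets_bound_large[OF fin big j(1) _ _ _ _ _ _ k g(1,2) _ num])
  show "order G \<le> 2 ^ (j + 1)" using j(2) by simp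
  obtain i where "j = Suc i" using j1(1) by (cases j) auto
  then show "(2::nat) ^ (j + 1) < 6 * 2 ^ (j - 1)" by simp
  have "(2::nat) ^ (5 * j) = (2 ^ j) ^ 5" by (simp add: power_mult[symmetric] mult.commute)
  then show "(2::nat) ^ (5 * j) \<le> (2 ^ j) ^ 5" by simp
  show "3 * (5 * j) \<le> 2 ^ j" using j1(2) by simp
  show "real (5 * j) + 1 \<le> 2 * (5 / 6 * real (2 ^ j) - real (5 * j)) * g\<^sup>2" using g(3) by simp
qed (use j1 in auto)

lemma bad_sets_bound_huge:
  assumes fin: "finite (carrier G)" and j: "2 ^ j \<le> order G" "order G < 2 ^ (j + 1)" "16 \<le> j"
    and k: "order G ^ 5 < 2 ^ (k + 1)" "2 * k + 1 \<le> order G"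
  shows "card (bad_sets G k) * order G < ((order G - 1) choose k)"
proof -
  define P :: real where "P = 2 ^ j"
  define c where "c = 5 * real j + 1"
  \<comment> \<open>The constant 20 makes \<open>g\<close> small enough for \<open>tail_base_le\<close> and large enough for \<open>g3\<close> below.\<close>
  define g where "g = sqrt (sqrt (1 / (20 * P)))"
  have P0: "0 < P" unfolding P_def by simp
  have g0: "0 \<le> g" unfolding g_def using P0 by simp
  have g2: "g\<^sup>2 = sqrt (1 / (20 * P))" unfolding g_def using P0 by simp
  have g4: "g ^ 4 = 1 / (20 * P)"
  proof -
    have "g ^ 4 = (g\<^sup>2)\<^sup>2" by (simp add: power2_eq_square eval_nat_numeral)
    then show ?thesis unfolding g2 using P0 by simp
  qed
  have "73 * (5 * j + 1)\<^sup>2 \<le> 10 * (2::nat) ^ j" by (rule poly_le_two_power[OF j(3)])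
  then have "real (73 * (5 * j + 1)\<^sup>2) \<le> real (10 * 2 ^ j)" by (rule of_nat_mono)
  then have P: "73 * c\<^sup>2 \<le> 10 * P" unfolding P_def c_def by (simp add: add.commute)
  have q: "81 \<le> c" using j(3) unfolding c_def by simp
  have "81 * c \<le> c\<^sup>2" unfolding power2_eq_square using q by (intro mult_right_mono) auto
  \<comment> \<open>Here 73 * 81 = 5913, and a tenth of it is just above 591.\<close>
  then have Pj: "591 * c \<le> P" using P q by linarith
  have P1: "65536 \<le> P"
  proof -
    have "(2::real) ^ 16 \<le> 2 ^ j" using j(3) by (intro power_increasing) auto
    then show ?thesis unfolding P_def by simp
  qed
  have g1: "g ^ 4 \<le> (5 / 6) ^ 4" unfolding g4 using P1 by (simp add: power_divide field_simps)
  then have g56: "g \<le> 5 / 6" by (rule power4_le_imp_le) simp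
  \<comment> \<open>The factor 1.66 lies slightly below 2 * 5/6; the gap, about P / 150, absorbs the
    term \<open>2 * (5 * real j)\<close> by \<open>Pj\<close>. After squaring, 1.66^2 / 20 exceeds
    10 / 73, so \<open>P\<close> applies.\<close>
  have "c \<le> (166 / 100 * P) * g\<^sup>2"
  proof (rule power2_le_imp_le)
    have "(166 / 100 * P * g\<^sup>2)\<^sup>2 = (166 / 100)\<^sup>2 * P\<^sup>2 * g ^ 4" by (simp add: power2_eq_square eval_nat_numeral)
    also have "\<dots> = (166 / 100)\<^sup>2 / 20 * P" unfolding g4 using P0 by (simp add: power2_eq_square)
    finally show "c\<^sup>2 \<le> (166 / 100 * P * g\<^sup>2)\<^sup>2" using P P0 by (simp add: power_divide)
    show "0 \<le> 166 / 100 * P * g\<^sup>2" using P0 by simp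
  qed
  also have "\<dots> \<le> 2 * (5 / 6 * P - 5 * real j) * g\<^sup>2" using Pj P0 unfolding c_def by (intro mult_right_mono) auto
  finally have g3: "5 * real j + 1 \<le> 2 * (5 / 6 * 2 ^ j - 5 * real j) * g\<^sup>2" unfolding P_def c_def .
  have "(\<Sum>s\<in>{1..j - 1}. tail_term (2 ^ (j + 1)) (5 * j) (j - 1) g s) \<le> (\<Sum>s\<in>{1..j - 1}. 1 / 2 ^ (s + 1))"
    using tail_term_le[OF j(3) _ _ g0 g4[unfolded P_def]] by (intro sum_mono) auto
  also have "\<dots> < 1" by (rule sum_halves_less_one)
  finally have num: "(\<Sum>s\<in>{1..j - 1}. tail_term (2 ^ (j + 1)) (5 * j) (j - 1) g s) < 1" .
  have "real (15 * j) \<le> real (2 ^ j)" using Pj unfolding P_def c_def by simp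
  then have j15: "15 * j \<le> 2 ^ j" by (simp only: of_nat_le_iff)
  have "120 < order G"
  proof -
    have "(2::nat) ^ 16 \<le> 2 ^ j" using j(3) by (intro power_increasing) auto
    then show ?thesis using j(1) by simp
  qed
  then show ?thesis using bad_sets_bound_dyadic[OF fin _ j(1,2) k _ j15 g0 g56 g3 num] j(3) by simp
qed

lemma bad_sets_bound_from_512:
  assumes fin: "finite (carrier G)" and n: "512 \<le> order G"
    and k: "order G ^ 5 < 2 ^ (k + 1)" "2 * k + 1 \<le> order G"
  shows "card (bad_sets G k) * order G < ((order G - 1) choose k)"
proof -
  have big: "120 < order G" using n by simp
  consider "order G \<le> 639" | "640 \<le> order G" "order G \<le> 1023" | "1024 \<le> order G" by linarith
  then show ?thesis
  proof cases
    case 1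
    have num: "(\<Sum>s\<in>{1..7}. tail_term 639 45 7 (1 / 4) s) < 1"
      by (rule sum_tail_less_one[OF tail_term_numeral(1)]) (simp_all add: upt_rec)
    show ?thesis
      by (rule bad_sets_bound_large[OF fin big n 1 _ _ _ _ _ k _ _ _ num]) (simp_all add: power2_eq_square)
  next
    case 2
    have num: "(\<Sum>s\<in>{1..8}. tail_term 1023 46 8 (2 / 9) s) < 1"
      by (rule sum_tail_less_one[OF tail_term_numeral(2)]) (simp_all add: upt_rec)
    show ?thesis
      by (rule bad_sets_bound_large[OF fin big 2 _ _ _ _ _ k _ _ _ num]) (simp_all add: power2_eq_square)
  next
    case 3
    obtain j where j: "2 ^ j \<le> order G" "order G < 2 ^ (j + 1)" using two_power_interval[of "order G"] n by auto
    have "j \<ge> 10"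
    proof (rule ccontr)
      assume "\<not> j \<ge> 10"
      then have "(2::nat) ^ (j + 1) \<le> 2 ^ 10" by (intro power_increasing) auto
      then show False using j(2) 3 by simp
    qed
    then consider "j = 10" | "j = 11" | "j = 12" | "j = 13" | "j = 14" | "j = 15" | "16 \<le> j" by linarith
    then show ?thesis
    proof cases
      case 1
      have num: "(\<Sum>s\<in>{1..j - 1}. tail_term (2 ^ (j + 1)) (5 * j) (j - 1) (9 / 50) s) < 1"
        using sum_tail_less_one[OF tail_term_numeral(3), of 9] by (simp add: 1 upt_rec)
      show ?thesis
        by (rule bad_sets_bound_dyadic[OF fin big j k _ _ _ _ _ num]) (simp_all add: 1 power2_eq_square)
    next
      case 2
      have num: "(\<Sum>s\<in>{1..j - 1}. tail_term (2 ^ (j + 1)) (5 * j) (j - 1) (2 / 15) s) < 1"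
        using sum_tail_less_one[OF tail_term_numeral(4), of 10] by (simp add: 2 upt_rec)
      show ?thesis
        by (rule bad_sets_bound_dyadic[OF fin big j k _ _ _ _ _ num]) (simp_all add: 2 power2_eq_square)
    next
      case 3
      have num: "(\<Sum>s\<in>{1..j - 1}. tail_term (2 ^ (j + 1)) (5 * j) (j - 1) (1 / 10) s) < 1"
        using sum_tail_less_one[OF tail_term_numeral(5), of 11] by (simp add: 3 upt_rec)
      show ?thesis
        by (rule bad_sets_bound_dyadic[OF fin big j k _ _ _ _ _ num]) (simp_all add: 3 power2_eq_square)
    next
      case 4
      have num: "(\<Sum>s\<in>{1..j - 1}. tail_term (2 ^ (j + 1)) (5 * j) (j - 1) (1 / 14) s) < 1"
        using sum_tail_less_one[OF tail_term_numeral(6), of 12] by (simp add: 4 upt_rec)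
      show ?thesis
        by (rule bad_sets_bound_dyadic[OF fin big j k _ _ _ _ _ num]) (simp_all add: 4 power2_eq_square)
    next
      case 5
      have num: "(\<Sum>s\<in>{1..j - 1}. tail_term (2 ^ (j + 1)) (5 * j) (j - 1) (1 / 19) s) < 1"
        using sum_tail_less_one[OF tail_term_numeral(7), of 13] by (simp add: 5 upt_rec)
      show ?thesis
        by (rule bad_sets_bound_dyadic[OF fin big j k _ _ _ _ _ num]) (simp_all add: 5 power2_eq_square)
    next
      case 6
      have num: "(\<Sum>s\<in>{1..j - 1}. tail_term (2 ^ (j + 1)) (5 * j) (j - 1) (1 / 26) s) < 1"
        using sum_tail_less_one[OF tail_term_numeral(8), of 14] by (simp add: 6 upt_rec)
      show ?thesis
        by (rule bad_sets_bound_dyadic[OF fin big j k _ _ _ _ _ num]) (simp_all add: 6 power2_eq_square)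
    next
      case 7
      then show ?thesis by (intro bad_sets_bound_huge[OF fin j _ k])
    qed
  qed
qed

end

section \<open>Proof of the theorem\<close>

lemma (in group) Aut_stab_complement:
  assumes R: "R \<subseteq> carrier G - {\<one>}"
  shows "Aut_stab G (carrier G - {\<one>} - R) = Aut_stab G R"
proof -
  let ?U = "carrier G - {\<one>}"
  have sub: "Aut_stab G S \<subseteq> Aut_stab G (?U - S)" if S: "S \<subseteq> ?U" for S
  proof
    fix f assume f: "f \<in> Aut_stab G S"
    then have fa: "f \<in> auto G" and fS: "f ` S = S" unfolding Aut_stab_def by auto
    have "inj_on f (carrier G)" using fa unfolding auto_def Bij_def bij_betw_def by auto
    then have "f ` (?U - S) = f ` ?U - f ` S"
      using S by (intro inj_on_image_set_diff[of f "carrier G"]) auto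
    then have "f ` (?U - S) = ?U - S" unfolding auto_image_nonid[OF fa] fS .
    then show "f \<in> Aut_stab G (?U - S)" using fa unfolding Aut_stab_def by simp
  qed
  have "?U - (?U - R) = R" using R by auto
  then show ?thesis using sub[OF R] sub[of "?U - R"] by auto
qed

text \<open>Complements within the nonidentity elements have the same stabiliser; this reduces the
  theorem to sets of at most half the size.\<close>

lemma (in group) card_bad_sets_complement:
  assumes fin: "finite (carrier G)" and k: "k \<le> order G - 1"
  shows "card (bad_sets G (order G - 1 - k)) = card (bad_sets G k)"
proof -
  let ?U = "carrier G - {\<one>}"
  have inv: "?U - R \<in> bad_sets G (order G - 1 - i)" "?U - (?U - R) = R"
    if R: "R \<in> bad_sets G i" for R i
  proof -
    have RU: "R \<subseteq> ?U" "card R = i" using R unfolding bad_sets_def S_k_def by auto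
    have "card (?U - R) = order G - 1 - i"
      using RU fin finite_subset[OF RU(1)] card_nonid[OF fin] by (simp add: card_Diff_subset)
    then show "?U - R \<in> bad_sets G (order G - 1 - i)"
      using R Aut_stab_complement[OF RU(1)] unfolding bad_sets_def S_k_def by auto
    show "?U - (?U - R) = R" using RU by auto
  qed
  have "order G - 1 - (order G - 1 - k) = k" using k by simp
  then have "bij_betw (\<lambda>R. ?U - R) (bad_sets G k) (bad_sets G (order G - 1 - k))"
    using inv(1)[of _ "order G - 1 - k"] inv by (intro bij_betw_byWitness[where f' = "\<lambda>R. ?U - R"]) auto
  then show ?thesis by (rule bij_betw_same_card[symmetric])
qed

text \<open>The smaller exponent is at most \<open>n / 2\<close>, so an upper bound on
  \<open>n\<close> bounds it, and \<open>n ^ 5 < 2 ^ c\<close> then yields a better bound on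
  \<open>n\<close>. Starting below 60 this descends through 56, 43, 19 and 4 to a
  contradiction.\<close>

lemma power5_order_ge_60:
  assumes n: "2 \<le> (n::nat)" and a: "n ^ 5 < 2 ^ a" "n ^ 5 < 2 ^ b" and ab: "a + b = n"
  shows "60 \<le> n"
proof (rule ccontr)
  assume "\<not> 60 \<le> n"
  define c where "c = min a b"
  have c: "n ^ 5 < 2 ^ c" "2 * c \<le> n" using a ab unfolding c_def min_def by auto
  have step: "n < y" if "c \<le> x" "2 ^ x \<le> y ^ 5" for x y
  proof (rule ccontr)
    assume "\<not> n < y"
    then have "y ^ 5 \<le> n ^ 5" by (intro power_mono) auto
    moreover have "(2::nat) ^ c \<le> 2 ^ x" using that(1) by (intro power_increasing) auto
    ultimately show False using c(1) that(2) by linarith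
  qed
  \<comment> \<open>The arguments 29, 27, 21, 9, 1 are half of the largest \<open>n\<close> still
    possible, rounded down.\<close>
  have "n < 56" by (rule step[of 29]) (use c(2) \<open>\<not> 60 \<le> n\<close> in simp_all)
  then have "n < 43" by (intro step[of 27]) (use c(2) in simp_all)
  then have "n < 19" by (intro step[of 21]) (use c(2) in simp_all)
  then have "n < 4" by (intro step[of 9]) (use c(2) in simp_all)
  then have "n < 2" by (intro step[of 1]) (use c(2) in simp_all)
  then show False using n by simp
qed

lemma log2_less_imp_power5:
  assumes "0 < n" "5 * log 2 (real n) < real m"
  shows "n ^ 5 < 2 ^ m"
proof -
  have "log 2 (real n ^ 5) < real m" using assms by (simp add: log_nat_power)
  then have "real n ^ 5 < 2 powr real m" using assms by (simp add: log_less_iff)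
  then have "real (n ^ 5) < real (2 ^ m)" by (simp add: powr_realpow)
  then show ?thesis by (simp only: of_nat_less_iff)
qed

theorem theorem7:
  fixes T :: "('a, 'b) monoid_scheme" and k :: int
  assumes "simple_group T"
    and "finite (carrier T)"
    and "\<not> comm_group T"
    and "5 * log 2 (real (card (carrier T))) < real_of_int k"
    and "real_of_int k < real (card (carrier T)) - 5 * log 2 (real (card (carrier T)))"
  shows "Q_k T (nat k) < 1 / real (card (carrier T))"
proof -
  interpret simple_group T by (rule assms(1))
  have fin: "finite (carrier T)" and nc: "\<not> comm_group T" by (rule assms)+
  define n where "n = card (carrier T)"
  have ord: "order T = n" unfolding order_def n_def ..
  have n2: "2 \<le> n" using order_gt_one ord by simp
  then have L0: "0 \<le> log 2 (real n)" by simp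
  define K where "K = nat k"
  \<comment> \<open>Positivity ensures that \<open>nat k\<close> is \<open>k\<close> and not the
    default 0 for negative integers.\<close>
  have k0: "0 < real_of_int k" using assms(4) L0 unfolding n_def by linarith
  then have kK: "real_of_int k = real K" unfolding K_def by simp
  have lo: "5 * log 2 (real n) < real K" using assms(4) kK unfolding n_def by simp
  have hi: "real K < real n - 5 * log 2 (real n)" using assms(5) kK unfolding n_def by simp
  have Kn: "K < n" using hi L0 by linarith
  have p1: "n ^ 5 < 2 ^ K" using lo n2 by (intro log2_less_imp_power5) auto
  have p2: "n ^ 5 < 2 ^ (n - K)" using hi n2 Kn by (intro log2_less_imp_power5) (auto simp: of_nat_diff)
  have n60: "60 \<le> n" using power5_order_ge_60[OF n2 p1 p2] Kn by simp
  \<comment> \<open>The exponent \<open>i + 1\<close> rather than \<open>i\<close> serves the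
    complementary size \<open>n - 1 - K\<close>, for which only \<open>n ^ 5 < 2 ^ (n - K)\<close>
    is known.\<close>
  have main: "card (bad_sets T i) * n < ((n - 1) choose i)" if i: "n ^ 5 < 2 ^ (i + 1)" "2 * i + 1 \<le> n" for i
  proof (cases "n < 512")
    case True
    then show ?thesis using bad_sets_bound_small[OF fin nc, of i] n60 i unfolding ord by simp
  next
    case False
    then show ?thesis using bad_sets_bound_from_512[OF fin, of i] i unfolding ord by simp
  qed
  have bound: "card (bad_sets T K) * n < ((n - 1) choose K)"
  proof (cases "2 * K + 1 \<le> n")
    case True
    have "n ^ 5 < 2 ^ (K + 1)" using p1 by simp
    then show ?thesis using main True by blast
  next
    case False
    have "n - 1 - K + 1 = n - K" using Kn by simp
    then have "card (bad_sets T (n - 1 - K)) * n < ((n - 1) choose (n - 1 - K))"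
      using main[of "n - 1 - K"] p2 False Kn by simp
    moreover have "card (bad_sets T (n - 1 - K)) = card (bad_sets T K)"
      using card_bad_sets_complement[OF fin, of K] Kn unfolding ord by simp
    moreover have "((n - 1) choose (n - 1 - K)) = ((n - 1) choose K)"
      using Kn by (intro binomial_symmetric[symmetric]) simp
    ultimately show ?thesis by simp
  qed
  have S: "card (S_k T K) = (n - 1) choose K"
    unfolding S_k_eq using card_ksubs[of "carrier T - {\<one>\<^bsub>T\<^esub>}" K] fin card_nonid[OF fin] ord by simp
  have "real (card (bad_sets T K)) * real n < real ((n - 1) choose K)"
    using bound by (metis of_nat_less_iff of_nat_mult)
  moreover have "0 < real ((n - 1) choose K)" using Kn by simp
  ultimately have "real (card (bad_sets T K)) / real ((n - 1) choose K) < 1 / real n"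
    using n2 by (simp add: field_simps)
  then show ?thesis unfolding Q_k_def bad_sets_def[symmetric] K_def[symmetric] S n_def[symmetric] .
qed

end
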